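(* Let $n\ge 0$ be an integer. The following conditions are equivalent for any locally compact and Lindel\"{o}f space $X$: (a) $\dim (\beta X \setminus X) \leq n$; (b) $\dim_{p}X \leq n+1$, i.e. any proper map $f \colon A \to {\mathbb R}^{n+1}$, defined on a closed subspace $A \subset X$, can be extended to a proper map $\bar{f} \colon X \to {\mathbb R}^{n+1}$.
   Context: All spaces are Tychonov and all maps are continuous. $\dim$ is the covering dimension, $\beta X$ is the Stone-Čech compactification of $X$, and a map is proper if preimages of compact sets are compact. $\dim_p X\le m$ is notation for the property that every proper map from a closed subspace of $X$ to ${\mathbb R}^m$ extends to a proper map $X\to{\mathbb R}^m$. *)

theory Defs
  imports "HOL-Analysis.Analysis"
begin

definition tychonoff_space :: "'a topology \<Rightarrow> bool"
  where "tychonoff_space X \<longleftrightarrow> completely_regular_space X \<and> Hausdorff_space X"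


section \<open>Covering dimension\<close>

text \<open>
  For Tychonoff spaces, covering dimension is defined by means of finite functionally open
  covers. For normal spaces, in particular for compact Hausdorff spaces, arbitrary finite open
  covers give the same notion; see \<open>covering_dim_le_normal_space\<close> below.
\<close>

definition functionally_open :: "'a topology \<Rightarrow> 'a set \<Rightarrow> bool"
  where "functionally_open X U \<longleftrightarrow>
    (\<exists>f. continuous_map X euclideanreal f \<and> U = {x \<in> topspace X. f x \<noteq> 0})"

text \<open>The order of a family is at most \<open>n\<close> if no point lies in more than \<open>n + 1\<close> members.\<close>

definition covering_dim_le :: "'a topology \<Rightarrow> nat \<Rightarrow> bool"
  where "covering_dim_le X n \<longleftrightarrow>
    (\<forall>\<U>. finite \<U> \<and> (\<forall>U\<in>\<U>. functionally_open X U) \<and> \<Union>\<U> = topspace X \<longrightarrow>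
      (\<exists>\<V>. finite \<V> \<and> (\<forall>V\<in>\<V>. functionally_open X V) \<and> \<Union>\<V> = topspace X \<and>
           (\<forall>V\<in>\<V>. \<exists>U\<in>\<U>. V \<subseteq> U) \<and>
           (\<forall>x\<in>topspace X. card {V \<in> \<V>. x \<in> V} \<le> n + 1)))"

lemma functionally_open_imp_openin:
  assumes "functionally_open X U"
  shows "openin X U"
proof -
  obtain f where f: "continuous_map X euclideanreal f" "U = {x \<in> topspace X. f x \<in> - {0}}"
    using assms by (auto simp: functionally_open_def)
  have "open (- {0::real})" by auto
  then show ?thesis
    using openin_continuous_map_preimage[OF f(1), of "- {0}"] f(2) by simp
qed

lemma normal_space_functionally_open_shrinking:
  assumes "normal_space X" "finite \<U>" "\<And>U. U \<in> \<U> \<Longrightarrow> openin X U" "\<Union>\<U> = topspace X"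
  obtains c where "\<And>U. U \<in> \<U> \<Longrightarrow> functionally_open X (c U) \<and> c U \<subseteq> U"
    and "\<Union>(c ` \<U>) = topspace X"
proof -
  have "\<exists>c. (\<forall>U\<in>\<F>. functionally_open X (c U) \<and> c U \<subseteq> U) \<and>
            topspace X \<subseteq> \<Union>(c ` \<F>) \<union> \<Union>(\<U> - \<F>)" if "finite \<F>" "\<F> \<subseteq> \<U>" for \<F>
    using that
  proof (induction \<F> rule: finite_induct)
    case empty
    then show ?case using assms(4) by auto
  next
    case (insert U \<F>)
    then obtain c where c: "\<forall>V\<in>\<F>. functionally_open X (c V) \<and> c V \<subseteq> V"
      and cov: "topspace X \<subseteq> \<Union>(c ` \<F>) \<union> \<Union>(\<U> - \<F>)" by auto
    let ?S = "topspace X - (\<Union>(c ` \<F>) \<union> \<Union>(\<U> - insert U \<F>))"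
    have oU: "openin X U" using insert assms(3) by auto
    have "openin X (\<Union>(c ` \<F>) \<union> \<Union>(\<U> - insert U \<F>))"
      using c assms(3) by (intro openin_Un openin_Union) (auto dest: functionally_open_imp_openin)
    then have clS: "closedin X ?S" by (intro closedin_diff closedin_topspace)
    have "\<Union>(\<U> - \<F>) \<subseteq> U \<union> \<Union>(\<U> - insert U \<F>)" by auto
    with cov have SU: "?S \<subseteq> U" by auto
    then have "disjnt (topspace X - U) ?S" by (auto simp: disjnt_def)
    then obtain f where f: "continuous_map X euclideanreal f"
        "f ` (topspace X - U) \<subseteq> {0}" "f ` ?S \<subseteq> {1}"
      using Urysohn_lemma_alt[OF assms(1) _ clS] oU by (metis closedin_diff closedin_topspace)
    define W where "W = {x \<in> topspace X. f x \<noteq> 0}"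
    have W1: "functionally_open X W"
      using f(1) unfolding W_def functionally_open_def by blast
    have W2: "W \<subseteq> U" using f(2) unfolding W_def by blast
    have W3: "?S \<subseteq> W"
    proof
      fix x assume "x \<in> ?S"
      then have "f x \<in> {1}" "x \<in> topspace X" using f(3) by (blast, blast)
      then show "x \<in> W" by (simp add: W_def)
    qed
    have "(c(U := W)) ` insert U \<F> = insert W (c ` \<F>)" using insert(2) by auto
    then have "\<Union>((c(U := W)) ` insert U \<F>) = W \<union> \<Union>(c ` \<F>)" by simp
    then have "topspace X \<subseteq> \<Union>((c(U := W)) ` insert U \<F>) \<union> \<Union>(\<U> - insert U \<F>)"
      using W3 by (simp only: Diff_subset_conv Un_ac)
    moreover have "\<forall>V\<in>insert U \<F>. functionally_open X ((c(U := W)) V) \<and> (c(U := W)) V \<subseteq> V"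
      using c W1 W2 by simp
    ultimately show ?case by blast
  qed
  from this[of \<U>] obtain c where c: "\<forall>U\<in>\<U>. functionally_open X (c U) \<and> c U \<subseteq> U"
    "topspace X \<subseteq> \<Union>(c ` \<U>)" using assms(2) by auto
  moreover have "\<Union>(c ` \<U>) \<subseteq> topspace X"
    using c(1) assms(4) by blast
  ultimately show ?thesis using that by blast
qed

lemma covering_dim_le_normal_space:
  assumes "normal_space X"
  shows "covering_dim_le X n \<longleftrightarrow>
    (\<forall>\<U>. finite \<U> \<and> (\<forall>U\<in>\<U>. openin X U) \<and> \<Union>\<U> = topspace X \<longrightarrow>
      (\<exists>\<V>. finite \<V> \<and> (\<forall>V\<in>\<V>. openin X V) \<and> \<Union>\<V> = topspace X \<and>
           (\<forall>V\<in>\<V>. \<exists>U\<in>\<U>. V \<subseteq> U) \<and>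
           (\<forall>x\<in>topspace X. card {V \<in> \<V>. x \<in> V} \<le> n + 1)))" (is "_ \<longleftrightarrow> ?rhs")
proof
  assume L: "covering_dim_le X n"
  show ?rhs
  proof (intro allI impI, elim conjE)
    fix \<U> assume U: "finite \<U>" "\<forall>U\<in>\<U>. openin X U" "\<Union>\<U> = topspace X"
    obtain c where c: "\<And>U. U \<in> \<U> \<Longrightarrow> functionally_open X (c U) \<and> c U \<subseteq> U"
      "\<Union>(c ` \<U>) = topspace X"
      using normal_space_functionally_open_shrinking[OF assms U(1) _ U(3)] U(2) by blast
    have "finite (c ` \<U>) \<and> (\<forall>U\<in>c ` \<U>. functionally_open X U) \<and> \<Union>(c ` \<U>) = topspace X"
      using U(1) c(1) c(2) by simp
    from L[unfolded covering_dim_le_def, THEN spec, THEN mp, OF this] obtain \<V> where V: "finite \<V>" "\<forall>V\<in>\<V>. functionally_open X V" "\<Union>\<V> = topspace X"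
      "\<forall>V\<in>\<V>. \<exists>U\<in>c ` \<U>. V \<subseteq> U" "\<forall>x\<in>topspace X. card {V \<in> \<V>. x \<in> V} \<le> n + 1"
      by (elim exE conjE) (rule that)
    have "\<exists>U\<in>\<U>. V \<subseteq> U" if V': "V \<in> \<V>" for V
    proof -
      obtain U where "U \<in> \<U>" "V \<subseteq> c U" using V(4) V' by auto
      then show ?thesis using c(1)[of U] by auto
    qed
    then show "\<exists>\<V>. finite \<V> \<and> (\<forall>V\<in>\<V>. openin X V) \<and> \<Union>\<V> = topspace X \<and>
           (\<forall>V\<in>\<V>. \<exists>U\<in>\<U>. V \<subseteq> U) \<and> (\<forall>x\<in>topspace X. card {V \<in> \<V>. x \<in> V} \<le> n + 1)"
      using V functionally_open_imp_openin[of X] by (intro exI[of _ \<V>] conjI ballI) simp_all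
  qed
next
  assume R: ?rhs
  show "covering_dim_le X n"
    unfolding covering_dim_le_def
  proof (intro allI impI, elim conjE)
    fix \<U> assume U: "finite \<U>" "\<forall>U\<in>\<U>. functionally_open X U" "\<Union>\<U> = topspace X"
    then have "finite \<U> \<and> (\<forall>U\<in>\<U>. openin X U) \<and> \<Union>\<U> = topspace X"
      by (simp add: functionally_open_imp_openin)
    from R[THEN spec, THEN mp, OF this] obtain \<V> where V: "finite \<V>" "\<forall>V\<in>\<V>. openin X V" "\<Union>\<V> = topspace X"
      "\<forall>V\<in>\<V>. \<exists>U\<in>\<U>. V \<subseteq> U" "\<forall>x\<in>topspace X. card {V \<in> \<V>. x \<in> V} \<le> n + 1"
      by (elim exE conjE) (rule that)
    obtain c where c: "\<And>V. V \<in> \<V> \<Longrightarrow> functionally_open X (c V) \<and> c V \<subseteq> V"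
      "\<Union>(c ` \<V>) = topspace X"
      using normal_space_functionally_open_shrinking[OF assms V(1) _ V(3)] V(2) by blast
    have "card {W \<in> c ` \<V>. x \<in> W} \<le> n + 1" if "x \<in> topspace X" for x
    proof -
      have "{W \<in> c ` \<V>. x \<in> W} \<subseteq> c ` {V \<in> \<V>. x \<in> V}"
      proof clarify
        fix V assume "V \<in> \<V>" "x \<in> c V"
        then show "c V \<in> c ` {V \<in> \<V>. x \<in> V}" using c(1)[of V] by auto
      qed
      then have "card {W \<in> c ` \<V>. x \<in> W} \<le> card {V \<in> \<V>. x \<in> V}"
        using V(1) by (intro surj_card_le) auto
      also have "\<dots> \<le> n + 1" using V(5) that by simp
      finally show ?thesis .
    qed
    moreover have "\<exists>U\<in>\<U>. c V \<subseteq> U" if V': "V \<in> \<V>" for V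
    proof -
      obtain U where "U \<in> \<U>" "V \<subseteq> U" using V(4) V' by auto
      then show ?thesis using c(1)[OF V'] by auto
    qed
    ultimately show "\<exists>\<V>. finite \<V> \<and> (\<forall>V\<in>\<V>. functionally_open X V) \<and> \<Union>\<V> = topspace X \<and>
           (\<forall>V\<in>\<V>. \<exists>U\<in>\<U>. V \<subseteq> U) \<and> (\<forall>x\<in>topspace X. card {V \<in> \<V>. x \<in> V} \<le> n + 1)"
      using V(1) c by (intro exI[of _ "c ` \<V>"] conjI) simp_all
  qed
qed


section \<open>Stone--Cech compactification\<close>

text \<open>
  The closure of the image of \<open>X\<close> under the evaluation map into the product of copies of
  \<open>[0,1]\<close> indexed by all continuous functions \<open>X \<rightarrow> [0,1]\<close>. Restricting to extensional
  functions makes the index set depend on the values on \<open>topspace X\<close> only.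
\<close>

definition unit_functions :: "'a topology \<Rightarrow> ('a \<Rightarrow> real) set"
  where "unit_functions X =
    {f \<in> extensional (topspace X). continuous_map X (top_of_set {0..1}) f}"

definition stone_cech_cube :: "'a topology \<Rightarrow> (('a \<Rightarrow> real) \<Rightarrow> real) topology"
  where "stone_cech_cube X =
    product_topology (\<lambda>f. top_of_set {0..1::real}) (unit_functions X)"

definition stone_cech_embedding :: "'a topology \<Rightarrow> 'a \<Rightarrow> ('a \<Rightarrow> real) \<Rightarrow> real"
  where "stone_cech_embedding X x = (\<lambda>f\<in>unit_functions X. f x)"

definition stone_cech :: "'a topology \<Rightarrow> (('a \<Rightarrow> real) \<Rightarrow> real) topology"
  where "stone_cech X = subtopology (stone_cech_cube X)
    (stone_cech_cube X closure_of (stone_cech_embedding X ` topspace X))"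

definition stone_cech_remainder :: "'a topology \<Rightarrow> (('a \<Rightarrow> real) \<Rightarrow> real) topology"
  where "stone_cech_remainder X = subtopology (stone_cech X)
    (topspace (stone_cech X) - stone_cech_embedding X ` topspace X)"

lemma compact_space_stone_cech: "compact_space (stone_cech X)"
proof -
  have "compact_space (stone_cech_cube X)"
    by (simp add: stone_cech_cube_def compact_space_product_topology compact_space_subtopology)
  then show ?thesis
    by (simp add: stone_cech_def closedin_compact_space compact_space_subtopology)
qed

lemma Hausdorff_space_stone_cech: "Hausdorff_space (stone_cech X)"
  by (simp add: stone_cech_def stone_cech_cube_def Hausdorff_space_subtopology
      Hausdorff_space_product_topology)

lemma stone_cech_embedding_in_cube:
  "stone_cech_embedding X ` topspace X \<subseteq> topspace (stone_cech_cube X)"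
  by (auto simp: stone_cech_cube_def stone_cech_embedding_def unit_functions_def
      continuous_map_in_subtopology Pi_iff split: if_splits)

lemma stone_cech_embedding_in_closure:
  "stone_cech_embedding X ` topspace X \<subseteq>
    stone_cech_cube X closure_of (stone_cech_embedding X ` topspace X)"
  by (rule closure_of_subset[OF stone_cech_embedding_in_cube])

lemma stone_cech_dense:
  "stone_cech X closure_of (stone_cech_embedding X ` topspace X) = topspace (stone_cech X)"
proof -
  define E where "E = stone_cech_embedding X ` topspace X"
  define C where "C = stone_cech_cube X closure_of E"
  have "E \<subseteq> C" "C \<subseteq> topspace (stone_cech_cube X)"
    unfolding C_def E_def by (rule stone_cech_embedding_in_closure closure_of_subset_topspace)+
  then have "C \<inter> E = E" "topspace (stone_cech_cube X) \<inter> C = C" by auto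
  then show ?thesis
    unfolding stone_cech_def E_def[symmetric] C_def[symmetric] topspace_subtopology
      closure_of_subtopology by (simp add: C_def)
qed

lemma embedding_map_stone_cech:
  assumes "tychonoff_space X"
  shows "embedding_map X (stone_cech X) (stone_cech_embedding X)"
proof -
  have eq: "mspace (submetric (cfunspace X euclidean_metric) {f. f \<in> topspace X \<rightarrow> {0..1::real}})
            = unit_functions X"
  proof -
    have "bounded (f ` topspace X)" if "f \<in> topspace X \<rightarrow> {0..1::real}" for f
    proof (rule bounded_subset)
      show "f ` topspace X \<subseteq> {0..1}" using that by (simp only: image_subset_iff_funcset)
    qed (rule bounded_closed_interval)
    then show ?thesis
      unfolding unit_functions_def continuous_map_in_subtopology mspace_submetric mspace_cfunspace
      by (auto simp: Pi_iff)
  qed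
  have "embedding_map X (stone_cech_cube X) (stone_cech_embedding X)"
    unfolding stone_cech_cube_def
  proof (rule embedding_map_eq)
    show "embedding_map X (product_topology (\<lambda>f. top_of_set {0..1::real}) (unit_functions X))
        (\<lambda>x. \<lambda>f\<in>unit_functions X. f x)"
      using assms unfolding tychonoff_space_def
      by (elim conjE) (rule completely_regular_space_cube_embedding_explicit[of X, unfolded eq])
  qed (simp only: stone_cech_embedding_def)
  then show ?thesis
    unfolding stone_cech_def embedding_map_in_subtopology
    by (intro conjI stone_cech_embedding_in_closure)
qed

lemma stone_cech_extension:
  assumes "continuous_map X (top_of_set {0..1::real}) f"
  obtains g where "continuous_map (stone_cech X) (top_of_set {0..1}) g"
    and "\<And>x. x \<in> topspace X \<Longrightarrow> g (stone_cech_embedding X x) = f x"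
proof
  let ?f = "restrict f (topspace X)"
  have mem: "?f \<in> unit_functions X"
    using continuous_map_eq[OF assms, of ?f] by (simp add: unit_functions_def)
  then show "continuous_map (stone_cech X) (top_of_set {0..1}) (\<lambda>u. u ?f)"
    unfolding stone_cech_def stone_cech_cube_def
    by (intro continuous_map_from_subtopology continuous_map_product_projection)
  show "\<And>x. x \<in> topspace X \<Longrightarrow> stone_cech_embedding X x ?f = f x"
    using mem by (simp add: stone_cech_embedding_def)
qed


section \<open>Extension of proper maps\<close>

definition proper_continuous_map :: "'a topology \<Rightarrow> 'b topology \<Rightarrow> ('a \<Rightarrow> 'b) \<Rightarrow> bool"
  where "proper_continuous_map X Y f \<longleftrightarrow> continuous_map X Y f \<and>
    (\<forall>K. compactin Y K \<longrightarrow> compactin X {x \<in> topspace X. f x \<in> K})"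

lemma proper_continuous_map_iff_proper_map:
  assumes "k_space Y" "Hausdorff_space Y"
  shows "proper_continuous_map X Y f \<longleftrightarrow> continuous_map X Y f \<and> proper_map X Y f"
proof -
  have "continuous_map X Y f \<Longrightarrow> f \<in> topspace X \<rightarrow> topspace Y"
    by (rule continuous_map_funspace)
  then show ?thesis
    unfolding proper_continuous_map_def
    using compact_imp_proper_map[OF assms(1) Hausdorff_imp_kc_space[OF assms(2)], of f X]
      compactin_proper_map_preimage[of X Y f] by metis
qed

definition proper_dim_le :: "'a topology \<Rightarrow> nat \<Rightarrow> bool"
  where "proper_dim_le X m \<longleftrightarrow>
    (\<forall>A f. closedin X A \<and> proper_continuous_map (subtopology X A) (Euclidean_space m) f \<longrightarrow>
      (\<exists>g. proper_continuous_map X (Euclidean_space m) g \<and> (\<forall>x\<in>A. g x = f x)))"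

end

theory Submission
  imports Defs
begin

text \<open>
  Write \<open>B\<close> for the Stone--Cech compactification, \<open>R\<close> for the remainder and \<open>m = n + 1\<close>. A proper
  map into \<open>\<real>\<^sup>m\<close> is large outside compact sets, so after division by its norm, where that exceeds one, it extends to
  a continuous map on \<open>B\<close> which has norm one on \<open>R\<close>. Hence extending proper maps over \<open>X\<close> amounts to
  extending nowhere vanishing maps from closed subsets of \<open>R\<close> to all of \<open>R\<close>, that is, extending maps
  into the sphere of dimension \<open>n\<close>; for the compact space \<open>R\<close> this characterises \<open>dim R \<le> n\<close>.
  Four facts carry the proof.

  \<^item> If \<open>dim K \<le> n\<close> and \<open>K\<close> is compact, every map \<open>K \<rightarrow> \<real>\<^sup>m\<close> is uniformly close to a map without
    zeros (\<open>covering_dim_le_imp_nonvanishing_approximation\<close>): a partition of unity subordinate to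
    a fine cover of order \<open>n\<close> moves the image into finitely many convex hulls of at most \<open>m\<close>
    points, and a small translation moves these off the origin.

  \<^item> If nowhere vanishing maps extend, then \<open>dim K \<le> n\<close>
    (\<open>nonvanishing_extension_imp_covering_dim_le\<close>). By Hemmingsen's argument it suffices to shrink
    covers with \<open>n + 2\<close> members to have empty intersection. A partition of unity maps \<open>K\<close> to the
    simplex with \<open>n + 2\<close> vertices, and the missing intersection corresponds to pushing this map
    off the barycentre.

  \<^item> Since \<open>X\<close> is locally compact and Lindelof, \<open>R\<close> is closed in \<open>B\<close> and is the zero set of a
    continuous function \<open>q\<close> on \<open>B\<close> (\<open>remainder_zero_set\<close>). Dividing by \<open>q\<close> makes nowhere vanishing
    maps on \<open>R\<close> into proper maps on subsets of \<open>X\<close>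
    (\<open>proper_dim_le_imp_nonvanishing_extension\<close>).

  \<^item> Conversely, the direction of a proper map on a closed set \<open>A\<close> is extended over \<open>B\<close> without zeros on \<open>R\<close>, and
    the reciprocal of its norm is extended over \<open>X\<close> to a positive function vanishing at \<open>R\<close>; the
    quotient of both is the required proper extension
    (\<open>covering_dim_le_imp_proper_dim_le\<close>).

  Maps into \<open>\<real>\<^sup>m\<close> are functions \<open>'a \<Rightarrow> nat \<Rightarrow> real\<close> of which only the coordinates below \<open>m\<close> count.
\<close>

section \<open>The sum norm on the first coordinates\<close>

definition l1 :: "nat \<Rightarrow> (nat \<Rightarrow> real) \<Rightarrow> real"
  where "l1 m v = (\<Sum>i<m. \<bar>v i\<bar>)"

lemma l1_nonneg: "0 \<le> l1 m v"
  by (simp add: l1_def sum_nonneg)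

lemma l1_pos_iff: "0 < l1 m v \<longleftrightarrow> (\<exists>i<m. v i \<noteq> 0)"
  unfolding l1_def by (subst less_le) (auto simp: sum_nonneg sum_nonneg_eq_0_iff)

lemma l1_cong: "(\<And>i. i < m \<Longrightarrow> v i = w i) \<Longrightarrow> l1 m v = l1 m w"
  by (simp add: l1_def)

lemma l1_triangle: "l1 m (\<lambda>i. v i + w i) \<le> l1 m v + l1 m w"
  by (simp add: l1_def sum.distrib [symmetric] sum_mono abs_triangle_ineq)

lemma l1_sum: "l1 m (\<lambda>i. \<Sum>j\<in>S. f j i) \<le> (\<Sum>j\<in>S. l1 m (f j))"
  unfolding l1_def by (subst sum.swap) (intro sum_mono sum_abs)

lemma l1_scale: "l1 m (\<lambda>i. c * v i) = \<bar>c\<bar> * l1 m v"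
  by (simp add: l1_def abs_mult sum_distrib_left)

lemma l1_divide: "l1 m (\<lambda>i. v i / c) = l1 m v / \<bar>c\<bar>"
  by (simp add: l1_def sum_divide_distrib)

lemma abs_le_l1: "i < m \<Longrightarrow> \<bar>v i\<bar> \<le> l1 m v"
  unfolding l1_def by (rule member_le_sum) auto

lemma continuous_map_l1 [continuous_intros]:
  assumes "\<And>i. i < m \<Longrightarrow> continuous_map K euclideanreal (\<lambda>x. F x i)"
  shows "continuous_map K euclideanreal (\<lambda>x. l1 m (F x))"
  unfolding l1_def using assms by (intro continuous_intros) auto

section \<open>Functionally open sets, partitions of unity and Tietze extensions\<close>

lemma functionally_open_lt:
  assumes "continuous_map K euclideanreal f" "continuous_map K euclideanreal g"
  shows "functionally_open K {x \<in> topspace K. f x < g x}"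
  unfolding functionally_open_def
  by (rule exI[of _ "\<lambda>x. max 0 (g x - f x)"]) (auto intro!: continuous_intros assms)

lemma functionally_open_partition_of_unity:
  assumes "finite I" "\<And>i. i \<in> I \<Longrightarrow> functionally_open K (U i)" "topspace K \<subseteq> (\<Union>i\<in>I. U i)"
  obtains \<phi> where "\<And>i. i \<in> I \<Longrightarrow> continuous_map K euclideanreal (\<phi> i)"
    "\<And>i x. i \<in> I \<Longrightarrow> x \<in> topspace K \<Longrightarrow> 0 \<le> \<phi> i x"
    "\<And>i x. i \<in> I \<Longrightarrow> x \<in> topspace K \<Longrightarrow> \<phi> i x \<noteq> 0 \<longleftrightarrow> x \<in> U i"
    "\<And>x. x \<in> topspace K \<Longrightarrow> (\<Sum>i\<in>I. \<phi> i x) = 1"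
proof -
  obtain f where f: "\<And>i. i \<in> I \<Longrightarrow> continuous_map K euclideanreal (f i)"
    "\<And>i. i \<in> I \<Longrightarrow> U i = {x \<in> topspace K. f i x \<noteq> 0}"
    using assms(2) unfolding functionally_open_def by metis
  define s where "s x = (\<Sum>i\<in>I. \<bar>f i x\<bar>)" for x
  have s: "s x > 0" if "x \<in> topspace K" for x
  proof -
    obtain i where i: "i \<in> I" "f i x \<noteq> 0"
      using \<open>x \<in> topspace K\<close> assms(3) f(2) by fast
    then have "\<bar>f i x\<bar> \<le> s x" unfolding s_def using assms(1) by (intro member_le_sum) auto
    with i show ?thesis by linarith
  qed
  have cs: "continuous_map K euclideanreal s"
    unfolding s_def by (intro continuous_intros assms f)
  show ?thesis
  proof (rule that[of "\<lambda>i x. \<bar>f i x\<bar> / s x"])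
    show "continuous_map K euclideanreal (\<lambda>x. \<bar>f i x\<bar> / s x)" if "i \<in> I" for i
    proof (intro continuous_intros cs f that)
      show "s x \<noteq> 0" if "x \<in> topspace K" for x using s[OF that] by simp
    qed
    show "0 \<le> \<bar>f i x\<bar> / s x" if "x \<in> topspace K" for i x
      using s[OF that] by simp
    show "\<bar>f i x\<bar> / s x \<noteq> 0 \<longleftrightarrow> x \<in> U i" if "i \<in> I" "x \<in> topspace K" for i x
      using s[of x] f(2)[of i] that by simp
    show "(\<Sum>i\<in>I. \<bar>f i x\<bar> / s x) = 1" if "x \<in> topspace K" for x
      using s[OF that] by (simp add: sum_divide_distrib [symmetric] s_def [symmetric])
  qed
qed

lemma functionally_open_Int:
  assumes "functionally_open K U" "functionally_open K V"
  shows "functionally_open K (U \<inter> V)"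
proof -
  obtain f g where "continuous_map K euclideanreal f" "U = {x \<in> topspace K. f x \<noteq> 0}"
    "continuous_map K euclideanreal g" "V = {x \<in> topspace K. g x \<noteq> 0}"
    using assms unfolding functionally_open_def by blast
  then show ?thesis
    unfolding functionally_open_def
    by (intro exI[of _ "\<lambda>x. f x * g x"]) (auto intro!: continuous_intros)
qed

lemma functionally_open_UN:
  assumes "finite I" "\<And>i. i \<in> I \<Longrightarrow> functionally_open K (U i)"
  shows "functionally_open K (\<Union>i\<in>I. U i)"
proof -
  obtain f where f: "\<And>i. i \<in> I \<Longrightarrow> continuous_map K euclideanreal (f i)"
    "\<And>i. i \<in> I \<Longrightarrow> U i = {x \<in> topspace K. f i x \<noteq> 0}"
    using assms(2) unfolding functionally_open_def by metis
  have "(\<Union>i\<in>I. U i) = {x \<in> topspace K. (\<Sum>i\<in>I. \<bar>f i x\<bar>) \<noteq> 0}"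
    using f(2) assms(1) by (auto simp: sum_nonneg_eq_0_iff)
  moreover have "continuous_map K euclideanreal (\<lambda>x. \<Sum>i\<in>I. \<bar>f i x\<bar>)"
    by (intro continuous_intros assms f)
  ultimately show ?thesis unfolding functionally_open_def by blast
qed

lemma Tietze_family:
  fixes F :: "'b \<Rightarrow> nat \<Rightarrow> real"
  assumes "normal_space Y" "closedin Y S" "is_interval T" "T \<noteq> {}"
    "\<And>i. i < m \<Longrightarrow> continuous_map (subtopology Y S) euclideanreal (\<lambda>y. F y i)"
    "\<And>i y. i < m \<Longrightarrow> y \<in> S \<Longrightarrow> F y i \<in> T"
  obtains F' where "\<And>i. i < m \<Longrightarrow> continuous_map Y euclideanreal (\<lambda>y. F' y i)"
    "\<And>i y. i < m \<Longrightarrow> y \<in> topspace Y \<Longrightarrow> F' y i \<in> T"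
    "\<And>i y. i < m \<Longrightarrow> y \<in> S \<Longrightarrow> F' y i = F y i"
proof -
  have "\<exists>g. continuous_map Y euclideanreal g \<and> (\<forall>y\<in>topspace Y. g y \<in> T) \<and> (\<forall>y\<in>S. g y = F y i)"
    if i: "i < m" for i
  proof -
    have "(\<lambda>y. F y i) ` S \<subseteq> T" using assms(6)[OF i] by blast
    from Tietze_extension_realinterval[OF assms(1-4) assms(5)[OF i] this]
    obtain g where "continuous_map Y euclideanreal g" "g ` topspace Y \<subseteq> T" "\<And>y. y \<in> S \<Longrightarrow> g y = F y i"
      by blast
    then show ?thesis by (intro exI[of _ g]) auto
  qed
  then obtain g where g: "\<And>i. i < m \<Longrightarrow> continuous_map Y euclideanreal (g i)"
    "\<And>i y. i < m \<Longrightarrow> y \<in> topspace Y \<Longrightarrow> g i y \<in> T" "\<And>i y. i < m \<Longrightarrow> y \<in> S \<Longrightarrow> g i y = F y i"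
    by metis
  show ?thesis by (rule that[of "\<lambda>y i. g i y"]) (use g in auto)
qed

lemma closedin_le:
  assumes "continuous_map Y euclideanreal u" "continuous_map Y euclideanreal v"
  shows "closedin Y {y \<in> topspace Y. u y \<le> v y}"
proof -
  have "closedin Y {y \<in> topspace Y. u y - v y \<in> {..0}}"
    using closedin_continuous_map_preimage[OF continuous_map_diff[OF assms], of "{..0}"] by simp
  then show ?thesis by simp
qed

section \<open>Covering dimension and approximation by maps without zeros\<close>

text \<open>
  Gaussian elimination: an unknown occurring in the first equation is eliminated from the others.
\<close>

lemma homogeneous_system_nontrivial_solution:
  fixes v :: "'j \<Rightarrow> 'i \<Rightarrow> real"
  assumes "finite J" "finite I" "card J < card I"
  shows "\<exists>c. (\<exists>i\<in>I. c i \<noteq> 0) \<and> (\<forall>j\<in>J. (\<Sum>i\<in>I. c i * v j i) = 0)"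
  using assms
proof (induction J arbitrary: I v rule: finite_induct)
  case empty
  then have "I \<noteq> {}" by auto
  then show ?case by (intro exI[of _ "\<lambda>_. 1"]) auto
next
  case (insert j J)
  show ?case
  proof (cases "\<forall>i\<in>I. v j i = 0")
    case True
    obtain c where "\<exists>i\<in>I. c i \<noteq> 0" "\<forall>j\<in>J. (\<Sum>i\<in>I. c i * v j i) = 0"
      using insert.IH[of I v] insert.prems insert.hyps by auto
    with True show ?thesis by (intro exI[of _ c]) auto
  next
    case False
    then obtain k where k: "k \<in> I" "v j k \<noteq> 0" by auto
    define I' where "I' = I - {k}"
    have I': "finite I'" "k \<notin> I'" "I = insert k I'" "card J < card I'"
      using insert.prems insert.hyps k by (auto simp: I'_def)
    obtain c where c: "\<exists>i\<in>I'. c i \<noteq> 0"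
      "\<forall>l\<in>J. (\<Sum>i\<in>I'. c i * (v l i - v l k * v j i / v j k)) = 0"
      using insert.IH[of I' "\<lambda>l i. v l i - v l k * v j i / v j k"] I' by auto
    define d where "d = c(k := - (\<Sum>i\<in>I'. c i * v j i) / v j k)"
    have d: "(\<Sum>i\<in>I. d i * v l i) = d k * v l k + (\<Sum>i\<in>I'. c i * v l i)" for l
    proof -
      have "(\<Sum>i\<in>I'. d i * v l i) = (\<Sum>i\<in>I'. c i * v l i)"
        using I'(2) by (intro sum.cong) (auto simp: d_def)
      then show ?thesis using I' by simp
    qed
    have "(\<Sum>i\<in>I. d i * v j i) = 0" using k by (simp add: d) (simp add: d_def)
    moreover have "(\<Sum>i\<in>I. d i * v l i) = 0" if "l \<in> J" for l
    proof -
      have "(\<Sum>i\<in>I'. c i * (v l i - v l k * v j i / v j k)) =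
            (\<Sum>i\<in>I'. c i * v l i) - v l k / v j k * (\<Sum>i\<in>I'. c i * v j i)"
        by (simp add: sum_distrib_left sum_subtractf algebra_simps)
      then show ?thesis using c(2) that k by (simp add: d) (simp add: d_def mult.commute)
    qed
    moreover have "\<exists>i\<in>I. d i \<noteq> 0" using c(1) I' by (auto simp: d_def)
    ultimately show ?thesis by (intro exI[of _ d]) auto
  qed
qed

text \<open>
  The affine hull of at most \<open>m\<close> points of \<open>\<real>\<^sup>m\<close> lies in a hyperplane, because the \<open>m + 1\<close>
  coefficients of its equation are constrained by at most \<open>m\<close> linear conditions. Along the moment
  curve \<open>(t, t\<^sup>2, \<dots>, t\<^sup>m)\<close> such an equation is a nonzero polynomial in \<open>t\<close>, so the curve contains
  points arbitrarily close to the origin that avoid any finite number of hulls.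
\<close>

lemma moment_curve_avoids_affine_hulls:
  fixes v :: "'j \<Rightarrow> nat \<Rightarrow> real"
  assumes "finite \<J>" "\<And>J. J \<in> \<J> \<Longrightarrow> finite J \<and> card J \<le> m" "0 < \<epsilon>"
  obtains t where "0 < t" "t < \<epsilon>"
    "\<And>J a. J \<in> \<J> \<Longrightarrow> sum a J = 1 \<Longrightarrow> \<exists>i<m. (\<Sum>j\<in>J. a j * v j i) \<noteq> t ^ Suc i"
proof -
  \<comment> \<open>The coordinate with index zero carries the constant term of the hyperplane.\<close>
  define w where "w j i = (case i of 0 \<Rightarrow> 1 | Suc i' \<Rightarrow> v j i')" for j i
  have "\<exists>c. (\<exists>i\<in>{..m}. c i \<noteq> 0) \<and> (\<forall>j\<in>J. (\<Sum>i\<le>m. c i * w j i) = 0)" if "J \<in> \<J>" for J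
    using homogeneous_system_nontrivial_solution[of J "{..m}" w] assms(2)[OF that]
    by auto
  then obtain c where c: "\<And>J. J \<in> \<J> \<Longrightarrow> \<exists>i\<in>{..m}. c J i \<noteq> 0"
      "\<And>J j. J \<in> \<J> \<Longrightarrow> j \<in> J \<Longrightarrow> (\<Sum>i\<le>m. c J i * w j i) = 0"
    by metis
  define Z where "Z = (\<Union>J\<in>\<J>. {t. (\<Sum>i\<le>m. c J i * t ^ i) = 0})"
  have "finite {t. (\<Sum>i\<le>m. c J i * t ^ i) = 0}" if "J \<in> \<J>" for J
    using c(1)[OF that] polyfun_roots_finite[of "c J" _ m] by auto
  then have "finite Z" unfolding Z_def using assms(1) by blast
  then have "infinite ({0<..<\<epsilon>} - Z)"
    using assms(3) by (simp add: infinite_Ioo)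
  then obtain t where t: "0 < t" "t < \<epsilon>" "t \<notin> Z"
    by (metis Diff_iff finite.emptyI ex_in_conv greaterThanLessThan_iff)
  show ?thesis
  proof (rule that[OF t(1,2)], rule ccontr)
    fix J a assume J: "J \<in> \<J>" "sum a J = 1"
      and "\<not> (\<exists>i<m. (\<Sum>j\<in>J. a j * v j i) \<noteq> t ^ Suc i)"
    then have eq: "(\<Sum>j\<in>J. a j * w j i) = t ^ i" if "i \<le> m" for i
      using that by (cases i) (auto simp: w_def)
    have "(\<Sum>i\<le>m. c J i * t ^ i) = (\<Sum>i\<le>m. \<Sum>j\<in>J. a j * (c J i * w j i))"
      by (simp add: eq [symmetric] sum_distrib_left algebra_simps)
    also have "\<dots> = (\<Sum>j\<in>J. a j * (\<Sum>i\<le>m. c J i * w j i))"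
      by (subst sum.swap) (simp add: sum_distrib_left)
    also have "\<dots> = 0" using c(2)[OF J(1)] by simp
    finally show False using t(3) J(1) by (auto simp: Z_def)
  qed
qed

text \<open>
  The map \<open>F\<close> is replaced by \<open>\<Sum>V. \<phi>\<^sub>V v\<^sub>V\<close>, where \<open>\<phi>\<close> is a partition of unity of order \<open>n\<close>
  and \<open>F\<close> stays close to the value \<open>v\<^sub>V\<close> on \<open>V\<close>. The image then lies in convex hulls of at most
  \<open>n + 1\<close> points of \<open>\<real>\<^sup>n\<^sup>+\<^sup>1\<close>, which are nowhere dense; subtracting a small vector outside of
  them removes all zeros.
\<close>

lemma covering_dim_le_imp_nonvanishing_approximation:
  assumes K: "compact_space K" and dim: "covering_dim_le K n"
    and F: "\<And>i. i < n + 1 \<Longrightarrow> continuous_map K euclideanreal (\<lambda>x. F x i)" and "0 < \<epsilon>"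
  obtains G where "\<And>i. i < n + 1 \<Longrightarrow> continuous_map K euclideanreal (\<lambda>x. G x i)"
    "\<And>x. x \<in> topspace K \<Longrightarrow> l1 (n + 1) (\<lambda>i. G x i - F x i) < \<epsilon>"
    "\<And>x. x \<in> topspace K \<Longrightarrow> 0 < l1 (n + 1) (G x)"
proof -
  let ?m = "n + 1"
  define N where "N a = {x \<in> topspace K. l1 ?m (\<lambda>i. F x i - F a i) < \<epsilon> / 2}" for a
  have N: "functionally_open K (N a)" for a
    unfolding N_def by (intro functionally_open_lt continuous_intros F)
  have "a \<in> N a" if "a \<in> topspace K" for a
    using that \<open>0 < \<epsilon>\<close> by (simp add: N_def l1_def)
  moreover have "N a \<subseteq> topspace K" for a by (auto simp: N_def)
  ultimately have "\<Union>(N ` topspace K) = topspace K" by blast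
  moreover have "\<forall>U\<in>N ` topspace K. openin K U"
    using N functionally_open_imp_openin by blast
  ultimately obtain \<U> where U: "finite \<U>" "\<U> \<subseteq> N ` topspace K" "\<Union>\<U> = topspace K"
    using K unfolding compact_space by (metis (no_types, lifting))
  have "finite \<U> \<and> (\<forall>U\<in>\<U>. functionally_open K U) \<and> \<Union>\<U> = topspace K"
    using U N by blast
  from dim[unfolded covering_dim_le_def, THEN spec, THEN mp, OF this] obtain \<V>
    where V: "finite \<V>" "\<forall>V\<in>\<V>. functionally_open K V" "\<Union>\<V> = topspace K"
      "\<forall>V\<in>\<V>. \<exists>U\<in>\<U>. V \<subseteq> U" "\<forall>x\<in>topspace K. card {V \<in> \<V>. x \<in> V} \<le> n + 1"
    by (elim exE conjE) (rule that)
  have "\<exists>a. V \<subseteq> N a" if "V \<in> \<V>" for V using V(4) U(2) that by blast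
  then obtain a where a: "\<And>V. V \<in> \<V> \<Longrightarrow> V \<subseteq> N (a V)" by metis
  obtain \<phi> where \<phi>: "\<And>V. V \<in> \<V> \<Longrightarrow> continuous_map K euclideanreal (\<phi> V)"
    "\<And>V x. V \<in> \<V> \<Longrightarrow> x \<in> topspace K \<Longrightarrow> 0 \<le> \<phi> V x"
    "\<And>V x. V \<in> \<V> \<Longrightarrow> x \<in> topspace K \<Longrightarrow> \<phi> V x \<noteq> 0 \<longleftrightarrow> x \<in> V"
    "\<And>x. x \<in> topspace K \<Longrightarrow> (\<Sum>V\<in>\<V>. \<phi> V x) = 1"
    using functionally_open_partition_of_unity[of \<V> K "\<lambda>V. V"] V by auto
  define v where "v V = F (a V)" for V
  have pos: "0 < min 1 (\<epsilon> / (2 * ?m))" using \<open>0 < \<epsilon>\<close> by simp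
  have fin: "finite {J. J \<subseteq> \<V> \<and> card J \<le> ?m}" using V(1) by simp
  have bd: "finite J \<and> card J \<le> ?m" if "J \<in> {J. J \<subseteq> \<V> \<and> card J \<le> ?m}" for J
    using that V(1) finite_subset by blast
  obtain t where t: "0 < t" "t < min 1 (\<epsilon> / (2 * ?m))"
    "\<And>J c. J \<in> {J. J \<subseteq> \<V> \<and> card J \<le> ?m} \<Longrightarrow> sum c J = 1 \<Longrightarrow>
       \<exists>i<?m. (\<Sum>V\<in>J. c V * v V i) \<noteq> t ^ Suc i"
    by (rule moment_curve_avoids_affine_hulls[OF fin bd pos, of v]) blast+
  define G where "G x i = (\<Sum>V\<in>\<V>. \<phi> V x * v V i) - t ^ Suc i" for x i
  show ?thesis
  proof
    show "continuous_map K euclideanreal (\<lambda>x. G x i)" for i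
      unfolding G_def by (intro continuous_intros V \<phi>(1)) auto
  next
    fix x assume x: "x \<in> topspace K"
    \<comment> \<open>Both the averaging and the translation contribute at most half of the permitted error.\<close>
    have "l1 ?m (\<lambda>i. \<Sum>V\<in>\<V>. \<phi> V x * (v V i - F x i)) \<le> (\<Sum>V\<in>\<V>. \<phi> V x * l1 ?m (\<lambda>i. v V i - F x i))"
      using l1_sum[of ?m "\<lambda>V i. \<phi> V x * (v V i - F x i)" \<V>] \<phi>(2)[OF _ x] by (simp add: l1_scale)
    also have "\<dots> \<le> (\<Sum>V\<in>\<V>. \<phi> V x * (\<epsilon> / 2))"
    proof (intro sum_mono)
      fix V assume V: "V \<in> \<V>"
      show "\<phi> V x * l1 ?m (\<lambda>i. v V i - F x i) \<le> \<phi> V x * (\<epsilon> / 2)"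
      proof (cases "x \<in> V")
        case True
        then have "l1 ?m (\<lambda>i. F x i - v V i) < \<epsilon> / 2" using a[OF V] by (auto simp: N_def v_def)
        then have "l1 ?m (\<lambda>i. v V i - F x i) \<le> \<epsilon> / 2" by (simp add: l1_def abs_minus_commute)
        then show ?thesis using \<phi>(2)[OF V x] by (rule mult_left_mono)
      next
        case False
        then show ?thesis using \<phi>(3)[OF V x] by auto
      qed
    qed
    also have "\<dots> = \<epsilon> / 2" using \<phi>(4)[OF x] by (metis mult_1 sum_distrib_right)
    finally have 1: "l1 ?m (\<lambda>i. \<Sum>V\<in>\<V>. \<phi> V x * (v V i - F x i)) \<le> \<epsilon> / 2" .
    have "l1 ?m (\<lambda>i. - (t ^ Suc i)) \<le> (\<Sum>i<?m. t)"
      unfolding l1_def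
    proof (intro sum_mono)
      fix i show "\<bar>- (t ^ Suc i)\<bar> \<le> t"
        using t(1,2) power_decreasing[of 1 "Suc i" t] by simp
    qed
    also have "\<dots> < \<epsilon> / 2" using t(2) by (simp add: field_simps)
    finally have 2: "l1 ?m (\<lambda>i. - (t ^ Suc i)) < \<epsilon> / 2" .
    have "G x i - F x i = (\<Sum>V\<in>\<V>. \<phi> V x * (v V i - F x i)) + (- (t ^ Suc i))" for i
      using \<phi>(4)[OF x]
      by (simp add: G_def right_diff_distrib sum_subtractf flip: sum_distrib_right)
    then show "l1 ?m (\<lambda>i. G x i - F x i) < \<epsilon>"
      using 1 2 l1_triangle[of ?m "\<lambda>i. \<Sum>V\<in>\<V>. \<phi> V x * (v V i - F x i)" "\<lambda>i. - (t ^ Suc i)"] by simp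
    \<comment> \<open>Only the at most \<open>n + 1\<close> members of the cover that contain the point contribute to the sum.\<close>
    define J where "J = {V \<in> \<V>. x \<in> V}"
    have J: "J \<subseteq> \<V>" "card J \<le> ?m" using V(5) x by (auto simp: J_def)
    have sJ: "(\<Sum>V\<in>\<V>. \<phi> V x * r V) = (\<Sum>V\<in>J. \<phi> V x * r V)" for r
      using \<phi>(3)[OF _ x] by (intro sum.mono_neutral_right V) (auto simp: J_def)
    have "(\<Sum>V\<in>J. \<phi> V x) = 1" using sJ[of "\<lambda>_. 1"] \<phi>(4)[OF x] by simp
    then obtain i where "i < ?m" "(\<Sum>V\<in>J. \<phi> V x * v V i) \<noteq> t ^ Suc i"
      using t(3)[of J "\<lambda>V. \<phi> V x"] J by auto
    then have "i < ?m" "G x i \<noteq> 0" by (auto simp: G_def sJ)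
    then show "0 < l1 ?m (G x)" by (auto simp: l1_pos_iff)
  qed
qed

section \<open>Extension of maps without zeros and covering dimension\<close>

text \<open>
  For compact Hausdorff \<open>K\<close> this says that every map from a closed subset of \<open>K\<close> to \<open>\<real>\<^sup>m - {0}\<close>
  extends to such a map on \<open>K\<close>: by Tietze's theorem one may start from a map \<open>F\<close> into \<open>\<real>\<^sup>m\<close> on all
  of \<open>K\<close>, and a bound \<open>\<epsilon>\<close> for its norm from below takes the place of the closed subset.
\<close>

definition nonvanishing_extension :: "'a topology \<Rightarrow> nat \<Rightarrow> bool"
  where "nonvanishing_extension K m \<longleftrightarrow>
    (\<forall>F \<epsilon>. (\<forall>i<m. continuous_map K euclideanreal (\<lambda>x. F x i)) \<and> 0 < \<epsilon> \<longrightarrow>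
      (\<exists>G. (\<forall>i<m. continuous_map K euclideanreal (\<lambda>x. G x i)) \<and>
           (\<forall>x\<in>topspace K. 0 < l1 m (G x) \<and> (\<epsilon> \<le> l1 m (F x) \<longrightarrow> (\<forall>i<m. G x i = F x i)))))"

text \<open>
  A partition of unity for \<open>U\<close> maps \<open>K\<close> to the simplex with \<open>n + 2\<close> vertices; in barycentric
  coordinates shifted by \<open>\<epsilon> = 1 / (n + 2)\<close> the barycentre becomes the origin of the hyperplane where the
  coordinates have sum zero. That hyperplane is identified with \<open>\<real>\<^sup>n\<^sup>+\<^sup>1\<close> by forgetting the last
  coordinate. The extension property moves the map off the origin to \<open>H\<close>, keeping it on the
  preimage of the boundary of the simplex. The sets where the coordinate \<open>i\<close> of \<open>H\<close> is not minimal
  cover \<open>K\<close> because \<open>H\<close> is not constant in \<open>i\<close>, and no point lies in all of them.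
\<close>

lemma nonvanishing_extension_imp_shrinking:
  fixes U :: "nat \<Rightarrow> 'a set"
  assumes ext: "nonvanishing_extension K (n + 1)"
    and U: "\<And>i. i \<le> n + 1 \<Longrightarrow> functionally_open K (U i)" "topspace K \<subseteq> (\<Union>i\<le>n + 1. U i)"
  obtains W where "\<And>i. i \<le> n + 1 \<Longrightarrow> functionally_open K (W i)" "\<And>i. i \<le> n + 1 \<Longrightarrow> W i \<subseteq> U i"
    "topspace K \<subseteq> (\<Union>i\<le>n + 1. W i)" "(\<Inter>i\<le>n + 1. W i) = {}"
proof -
  define \<epsilon> :: real where "\<epsilon> = 1 / (n + 2)"
  obtain \<phi> where \<phi>: "\<And>i. i \<le> n + 1 \<Longrightarrow> continuous_map K euclideanreal (\<phi> i)"
    "\<And>i x. i \<le> n + 1 \<Longrightarrow> x \<in> topspace K \<Longrightarrow> 0 \<le> \<phi> i x"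
    "\<And>i x. i \<le> n + 1 \<Longrightarrow> x \<in> topspace K \<Longrightarrow> \<phi> i x \<noteq> 0 \<longleftrightarrow> x \<in> U i"
    "\<And>x. x \<in> topspace K \<Longrightarrow> (\<Sum>i\<le>n + 1. \<phi> i x) = 1"
    using functionally_open_partition_of_unity[of "{..n + 1}" K U] U
    by (metis atMost_iff finite_atMost)
  define F where "F x i = \<phi> i x - \<epsilon>" for x i
  have "0 < \<epsilon>" by (simp add: \<epsilon>_def)
  moreover have "\<forall>i<n + 1. continuous_map K euclideanreal (\<lambda>x. F x i)"
    unfolding F_def by (auto intro!: continuous_intros \<phi>(1))
  ultimately have "\<exists>G. (\<forall>i<n + 1. continuous_map K euclideanreal (\<lambda>x. G x i)) \<and>
      (\<forall>x\<in>topspace K. 0 < l1 (n + 1) (G x) \<and>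
        (\<epsilon> \<le> l1 (n + 1) (F x) \<longrightarrow> (\<forall>i<n + 1. G x i = F x i)))"
    by (intro ext[unfolded nonvanishing_extension_def, THEN spec, THEN spec, THEN mp]) (rule conjI)
  then obtain G where G: "\<And>i. i < n + 1 \<Longrightarrow> continuous_map K euclideanreal (\<lambda>x. G x i)"
    "\<And>x. x \<in> topspace K \<Longrightarrow> 0 < l1 (n + 1) (G x)"
    "\<And>x i. x \<in> topspace K \<Longrightarrow> \<epsilon> \<le> l1 (n + 1) (F x) \<Longrightarrow> i < n + 1 \<Longrightarrow> G x i = F x i"
    by blast
  have split: "(\<Sum>i\<le>n + 1. a i) = (\<Sum>i<n + 1. a i) + a (n + 1)" for a :: "nat \<Rightarrow> real"
  proof -
    have "{..n + 1} = insert (n + 1) {..<n + 1}" by auto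
    then show ?thesis by (metis add.commute finite_lessThan lessThan_iff less_irrefl sum.insert)
  qed
  define H where "H x i = (if i < n + 1 then G x i else - (\<Sum>j<n + 1. G x j))" for x i
  have H: "continuous_map K euclideanreal (\<lambda>x. H x i)" for i
    unfolding H_def by (cases "i < n + 1") (auto intro!: continuous_intros G(1))
  define W where "W i = {x \<in> topspace K. 0 < \<phi> i x * (\<Sum>j\<le>n + 1. max 0 (H x i - H x j))}" for i
  have max_zero: "max 0 (a - b) = 0 \<longleftrightarrow> \<not> b < a" for a b :: real by auto
  have W: "x \<in> W i \<longleftrightarrow> x \<in> topspace K \<and> x \<in> U i \<and> (\<exists>j\<le>n + 1. H x j < H x i)"
    if i: "i \<le> n + 1" for i x
  proof (cases "x \<in> topspace K")
    case True
    have "0 < (\<Sum>j\<le>n + 1. max 0 (H x i - H x j)) \<longleftrightarrow> (\<Sum>j\<le>n + 1. max 0 (H x i - H x j)) \<noteq> 0"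
      by (simp add: less_le sum_nonneg del: sum.atMost_Suc)
    also have "\<dots> \<longleftrightarrow> (\<exists>j\<le>n + 1. H x j < H x i)"
      by (subst sum_nonneg_eq_0_iff) (auto simp: max_zero)
    finally show ?thesis
      using True \<phi>(2,3)[OF i True] by (auto simp: W_def zero_less_mult_iff)
  qed (auto simp: W_def)
  show ?thesis
  proof
    fix i assume i: "i \<le> n + 1"
    show "functionally_open K (W i)"
      unfolding W_def by (intro functionally_open_lt continuous_intros \<phi>(1) i H) auto
    show "W i \<subseteq> U i" using W[OF i] by blast
  next
    show "topspace K \<subseteq> (\<Union>i\<le>n + 1. W i)"
    proof
      fix x assume x: "x \<in> topspace K"
      have sum0: "(\<Sum>i\<le>n + 1. H x i) = 0"
        unfolding split by (simp add: H_def)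
      have "\<exists>i\<le>n + 1. \<exists>j\<le>n + 1. H x j < H x i"
      proof (rule ccontr)
        assume "\<not> ?thesis"
        then have const: "H x i = H x 0" if "i \<le> n + 1" for i
          using that by (metis le0 linorder_less_linear)
        have "(\<Sum>i\<le>n + 1. H x i) = (\<Sum>i\<le>n + 1. H x 0)"
          by (intro sum.cong refl const) simp
        then have "(n + 2) * H x 0 = 0" using sum0 by simp
        then have "H x 0 = 0" by simp
        then have "H x i = 0" if "i \<le> n + 1" for i
          using const[OF that] by simp
        then have "G x i = 0" if "i < n + 1" for i
          using that by (metis H_def less_imp_le)
        then show False using G(2)[OF x] unfolding l1_pos_iff by blast
      qed
      then obtain i j where ij: "i \<le> n + 1" "j \<le> n + 1" "H x j < H x i" by blast
      \<comment> \<open>On the boundary of the simplex a non-minimal coordinate of \<open>H\<close> belongs to a positive \<open>\<phi> i\<close>;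
        in its interior all \<open>\<phi> i\<close> are positive.\<close>
      have "x \<in> U i"
      proof (cases "\<exists>k\<le>n + 1. \<phi> k x = 0")
        case False
        then show ?thesis using \<phi>(3)[OF ij(1) x] ij(1) by auto
      next
        case True
        then obtain k where k: "k \<le> n + 1" "\<phi> k x = 0" by blast
        have sumF: "(\<Sum>i<n + 1. F x i) = - (\<phi> (n + 1) x - \<epsilon>)"
        proof -
          have "(\<Sum>i<n + 1. F x i) = (\<Sum>i<n + 1. \<phi> i x) - (n + 1) * \<epsilon>"
            unfolding F_def sum_subtractf by simp
          moreover have "(\<Sum>i<n + 1. \<phi> i x) = 1 - \<phi> (n + 1) x"
            using \<phi>(4)[OF x] unfolding split by linarith
          moreover have "(n + 1) * \<epsilon> = 1 - \<epsilon>" by (simp add: \<epsilon>_def field_simps)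
          ultimately show ?thesis by linarith
        qed
        have "\<epsilon> \<le> l1 (n + 1) (F x)"
        proof (cases "k < n + 1")
          case True
          then show ?thesis using abs_le_l1[OF True, of "F x"] k \<open>0 < \<epsilon>\<close> by (simp add: F_def)
        next
          case False
          then have "k = n + 1" using k by simp
          then have "\<bar>\<Sum>i<n + 1. F x i\<bar> = \<epsilon>" unfolding sumF using k \<open>0 < \<epsilon>\<close> by simp
          then show ?thesis unfolding l1_def by (metis sum_abs)
        qed
        then have GF: "G x i = F x i" if "i < n + 1" for i using G(3)[OF x] that by blast
        have "(\<Sum>j<n + 1. G x j) = (\<Sum>j<n + 1. F x j)" using GF by (intro sum.cong) auto
        then have "H x l = \<phi> l x - \<epsilon>" if "l \<le> n + 1" for l
          using that GF sumF by (cases "l < n + 1") (auto simp: H_def F_def le_Suc_eq)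
        then have "\<phi> j x < \<phi> i x" using ij by simp
        then show ?thesis using \<phi>(2)[OF ij(2) x] \<phi>(3)[OF ij(1) x] by auto
      qed
      then show "x \<in> (\<Union>i\<le>n + 1. W i)" using W[OF ij(1)] x ij by blast
    qed
  next
    show "(\<Inter>i\<le>n + 1. W i) = {}"
    proof (rule equals0I)
      fix x assume x: "x \<in> (\<Inter>i\<le>n + 1. W i)"
      have "Min (H x ` {..n + 1}) \<in> H x ` {..n + 1}" by (rule Min_in) auto
      then obtain i where i: "i \<in> {..n + 1}" "H x i = Min (H x ` {..n + 1})" by (metis imageE)
      have min: "H x i \<le> H x j" if "j \<le> n + 1" for j
        unfolding i(2) using that by (intro Min_le) auto
      have "x \<in> W i" using x i by blast
      then show False using W[of i x] i(1) min by (metis atMost_iff leD)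
    qed
  qed
qed

text \<open>
  Hemmingsen's reduction to covers with \<open>n + 2\<close> members. For one subfamily \<open>S\<close> of this size, merge
  a chosen member \<open>i0\<close> and everything outside \<open>S\<close> into a single set, shrink the resulting cover,
  and intersect each of the merged sets with the shrunken union. Later shrinking steps preserve
  empty intersections, so that the subfamilies can be treated one after the other.
\<close>

lemma nonvanishing_extension_imp_disjoint_subfamilies:
  assumes ext: "nonvanishing_extension K (n + 1)"
    and I: "finite I" "\<And>i. i \<in> I \<Longrightarrow> functionally_open K (U i)" "topspace K \<subseteq> (\<Union>i\<in>I. U i)"
    and S: "finite \<S>" "\<And>S. S \<in> \<S> \<Longrightarrow> S \<subseteq> I \<and> card S = n + 2"
  shows "\<exists>W. (\<forall>i\<in>I. functionally_open K (W i) \<and> W i \<subseteq> U i) \<and> topspace K \<subseteq> (\<Union>i\<in>I. W i) \<and>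
             (\<forall>S\<in>\<S>. (\<Inter>i\<in>S. W i) = {})"
  using S
proof (induction \<S> rule: finite_induct)
  case empty
  show ?case using I by (intro exI[of _ U]) auto
next
  case (insert S \<S>)
  have "\<exists>W. (\<forall>i\<in>I. functionally_open K (W i) \<and> W i \<subseteq> U i) \<and> topspace K \<subseteq> (\<Union>i\<in>I. W i) \<and>
             (\<forall>S\<in>\<S>. (\<Inter>i\<in>S. W i) = {})"
    by (rule insert.IH) (rule insert.prems, rule insertI2)
  then obtain W where W: "\<And>i. i \<in> I \<Longrightarrow> functionally_open K (W i)" "\<And>i. i \<in> I \<Longrightarrow> W i \<subseteq> U i"
    "topspace K \<subseteq> (\<Union>i\<in>I. W i)" "\<And>S. S \<in> \<S> \<Longrightarrow> (\<Inter>i\<in>S. W i) = {}"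
    by blast
  have S: "S \<subseteq> I" "card S = n + 2" using insert.prems by auto
  then obtain i0 where i0: "i0 \<in> S" by fastforce
  define S' where "S' = S - {i0}"
  have "finite S'" "card S' = n + 1" "S' \<subseteq> I"
    using S i0 finite_subset[OF S(1) I(1)] by (auto simp: S'_def)
  then obtain h where h: "bij_betw h {0..<n + 1} S'"
    using ex_bij_betw_nat_finite by metis
  define g where "g = inv_into {0..<n + 1} h"
  have hS: "h j \<in> S'" if "j < n + 1" for j
    using bij_betwE[OF h] that by simp
  have gh: "g (h j) = j" if "j < n + 1" for j
    unfolding g_def using bij_betw_inv_into_left[OF h] that by simp
  have g: "g i < n + 1" "h (g i) = i" if "i \<in> S'" for i
    using bij_betw_inv_into[OF h] bij_betw_inv_into_right[OF h] that
    unfolding g_def by (auto dest: bij_betwE)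
  define U' where "U' j = (if j < n + 1 then W (h j) else (\<Union>i\<in>I - S'. W i))" for j
  have "functionally_open K (U' j)" if "j \<le> n + 1" for j
    unfolding U'_def using hS \<open>S' \<subseteq> I\<close> I(1) by (auto intro!: functionally_open_UN W(1))
  moreover have "topspace K \<subseteq> (\<Union>j\<le>n + 1. U' j)"
  proof
    fix x assume "x \<in> topspace K"
    then obtain i where i: "i \<in> I" "x \<in> W i" using W(3) by blast
    show "x \<in> (\<Union>j\<le>n + 1. U' j)"
    proof (cases "i \<in> S'")
      case True
      then have "g i \<le> n + 1" "x \<in> U' (g i)" using i g[OF True] by (auto simp: U'_def)
      then show ?thesis by blast
    next
      case False
      then have "x \<in> U' (n + 1)" using i by (auto simp: U'_def)
      then show ?thesis by blast
    qed
  qed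
  ultimately obtain V where V: "\<And>j. j \<le> n + 1 \<Longrightarrow> functionally_open K (V j)"
    "\<And>j. j \<le> n + 1 \<Longrightarrow> V j \<subseteq> U' j" "topspace K \<subseteq> (\<Union>j\<le>n + 1. V j)" "(\<Inter>j\<le>n + 1. V j) = {}"
    using nonvanishing_extension_imp_shrinking[OF ext, of U'] by blast
  define W' where "W' i = (if i \<in> S' then V (g i) else W i \<inter> V (n + 1))" for i
  have sub: "W' i \<subseteq> W i" for i
  proof (cases "i \<in> S'")
    case True
    then show ?thesis using V(2)[of "g i"] g[OF True] by (simp add: W'_def U'_def)
  qed (auto simp: W'_def)
  show ?case
  proof (intro exI[of _ W'] conjI ballI)
    fix i assume i: "i \<in> I"
    show "functionally_open K (W' i)"
    proof (cases "i \<in> S'")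
      case True
      then show ?thesis using V(1)[of "g i"] g(1)[OF True] by (simp add: W'_def)
    next
      case False
      then show ?thesis
        using functionally_open_Int[OF W(1)[OF i] V(1)[of "n + 1"]] by (simp add: W'_def)
    qed
    show "W' i \<subseteq> U i" using sub[of i] W(2)[OF i] by blast
  next
    show "topspace K \<subseteq> (\<Union>i\<in>I. W' i)"
    proof
      fix x assume "x \<in> topspace K"
      then obtain j where j: "j \<le> n + 1" "x \<in> V j" using V(3) by blast
      show "x \<in> (\<Union>i\<in>I. W' i)"
      proof (cases "j < n + 1")
        case True
        then have "h j \<in> I" "x \<in> W' (h j)" using hS[OF True] gh[OF True] j \<open>S' \<subseteq> I\<close> by (auto simp: W'_def)
        then show ?thesis by blast
      next
        case False
        then have "j = n + 1" using j by simp
        then have x: "x \<in> V (n + 1)" "x \<in> U' (n + 1)" using j V(2)[of j] by auto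
        then obtain i where "i \<in> I - S'" "x \<in> W i" by (auto simp: U'_def)
        then have "i \<in> I" "x \<in> W' i" using x by (auto simp: W'_def)
        then show ?thesis by blast
      qed
    qed
  next
    fix T assume T: "T \<in> insert S \<S>"
    show "(\<Inter>i\<in>T. W' i) = {}"
    proof (cases "T = S")
      case True
      have "x \<in> V j" if x: "x \<in> (\<Inter>i\<in>S. W' i)" and j: "j \<le> n + 1" for x j
      proof (cases "j < n + 1")
        case True
        then have "x \<in> W' (h j)" using x hS[OF True] by (auto simp: S'_def)
        then show ?thesis using hS[OF True] gh[OF True] by (simp add: W'_def)
      next
        case False
        then have "x \<in> W' i0" "j = n + 1" using x i0 j by auto
        then show ?thesis by (simp add: W'_def S'_def)
      qed
      then show ?thesis using V(4) unfolding True by blast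
    next
      case False
      then have "(\<Inter>i\<in>T. W i) = {}" using T W(4) by blast
      then show ?thesis using sub by blast
    qed
  qed
qed

text \<open>
  A cover whose subfamilies with \<open>n + 2\<close> members have empty intersection has order at most \<open>n\<close>.
  The family is indexed by the given cover itself, so different indices may yield equal sets; this
  can only lower the order.
\<close>

lemma nonvanishing_extension_imp_covering_dim_le:
  assumes ext: "nonvanishing_extension K (n + 1)"
  shows "covering_dim_le K n"
  unfolding covering_dim_le_def
proof (intro allI impI, elim conjE)
  fix \<U> assume U: "finite \<U>" "\<forall>U\<in>\<U>. functionally_open K U" "\<Union>\<U> = topspace K"
  define \<S> where "\<S> = {S. S \<subseteq> \<U> \<and> card S = n + 2}"
  have fin: "finite \<S>" unfolding \<S>_def using U(1) by simp
  have "\<exists>W. (\<forall>V\<in>\<U>. functionally_open K (W V) \<and> W V \<subseteq> V) \<and>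
      topspace K \<subseteq> (\<Union>V\<in>\<U>. W V) \<and> (\<forall>S\<in>\<S>. (\<Inter>V\<in>S. W V) = {})"
    by (rule nonvanishing_extension_imp_disjoint_subfamilies[OF ext U(1) _ _ fin])
      (use U in \<open>auto simp: \<S>_def\<close>)
  then obtain W where W: "\<forall>V\<in>\<U>. functionally_open K (W V) \<and> W V \<subseteq> V"
    "topspace K \<subseteq> (\<Union>V\<in>\<U>. W V)" "\<forall>S\<in>\<S>. (\<Inter>V\<in>S. W V) = {}"
    by blast
  show "\<exists>\<V>. finite \<V> \<and> (\<forall>V\<in>\<V>. functionally_open K V) \<and> \<Union>\<V> = topspace K \<and>
           (\<forall>V\<in>\<V>. \<exists>U\<in>\<U>. V \<subseteq> U) \<and> (\<forall>x\<in>topspace K. card {V \<in> \<V>. x \<in> V} \<le> n + 1)"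
  proof (intro exI[of _ "W ` \<U>"] conjI ballI)
    show "\<Union>(W ` \<U>) = topspace K" using W(1,2) U(3) by blast
    show "\<exists>U\<in>\<U>. V \<subseteq> U" if VW: "V \<in> W ` \<U>" for V
    proof -
      obtain U where "U \<in> \<U>" "V = W U" using VW by blast
      then show ?thesis using W(1) by blast
    qed
    show "functionally_open K V" if "V \<in> W ` \<U>" for V using that W(1) by fast
    show "finite (W ` \<U>)" using U(1) by simp
    fix x assume "x \<in> topspace K"
    let ?T = "{V \<in> \<U>. x \<in> W V}"
    have "card {V \<in> W ` \<U>. x \<in> V} \<le> card ?T"
      using U(1) by (intro surj_card_le[of ?T _ W]) auto
    also have "\<dots> \<le> n + 1"
    proof (rule ccontr)
      assume "\<not> card ?T \<le> n + 1"
      then obtain S where "S \<subseteq> ?T" "card S = n + 2"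
        using obtain_subset_with_card_n[of "n + 2" ?T] by auto
      then have "S \<in> \<S>" "x \<in> (\<Inter>V\<in>S. W V)" by (auto simp: \<S>_def)
      then show False using W(3) by blast
    qed
    finally show "card {V \<in> W ` \<U>. x \<in> V} \<le> n + 1" .
  qed
qed

section \<open>Proper maps into Euclidean space\<close>

lemma compactin_l1_ball: "compactin (Euclidean_space m) {v \<in> topspace (Euclidean_space m). l1 m v \<le> M}"
proof -
  have proj: "continuous_map (Euclidean_space m) euclideanreal (\<lambda>v. v i)" for i
    unfolding Euclidean_space_def
    by (intro continuous_map_from_subtopology continuous_map_product_projection) auto
  have "compactin (powertop_real UNIV) (PiE UNIV (\<lambda>i::nat. {- M..M}))"
    by (subst compactin_PiE) (auto simp: compact_Icc)
  then have "compactin (powertop_real UNIV) (topspace (Euclidean_space m) \<inter> PiE UNIV (\<lambda>i. {- M..M}))"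
    by (rule closed_Int_compactin[OF closedin_Euclidean_space])
  then have *: "compactin (Euclidean_space m) (topspace (Euclidean_space m) \<inter> PiE UNIV (\<lambda>i. {- M..M}))"
    unfolding Euclidean_space_def compactin_subtopology by auto
  show ?thesis
  proof (rule closed_compactin[OF *])
    show "closedin (Euclidean_space m) {v \<in> topspace (Euclidean_space m). l1 m v \<le> M}"
      using closedin_continuous_map_preimage[of _ euclideanreal "\<lambda>v. l1 m v" "{..M}"]
        continuous_map_l1[of m "Euclidean_space m" "\<lambda>v. v"] proj by simp
    show "{v \<in> topspace (Euclidean_space m). l1 m v \<le> M} \<subseteq>
        topspace (Euclidean_space m) \<inter> PiE UNIV (\<lambda>i. {- M..M})"
    proof
      fix v assume v: "v \<in> {v \<in> topspace (Euclidean_space m). l1 m v \<le> M}"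
      have "\<bar>v i\<bar> \<le> M" for i
        using v abs_le_l1[of i m v] l1_nonneg[of m v]
        by (cases "i < m") (auto simp: topspace_Euclidean_space)
      then show "v \<in> topspace (Euclidean_space m) \<inter> PiE UNIV (\<lambda>i. {- M..M})"
        using v by (auto simp: abs_le_iff minus_le_iff)
    qed
  qed
qed

lemma continuous_map_Euclidean_space_component:
  assumes "continuous_map Y (Euclidean_space m) f"
  shows "continuous_map Y euclideanreal (\<lambda>y. f y i)"
proof -
  have "continuous_map (Euclidean_space m) euclideanreal (\<lambda>v. v i)"
    unfolding Euclidean_space_def
    by (intro continuous_map_from_subtopology continuous_map_product_projection) auto
  from continuous_map_compose[OF assms this] show ?thesis by (simp add: o_def)
qed

text \<open>
  Closed norm balls are compact and every compact subset of Euclidean space lies in one of them, so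
  properness is a condition on the sublevel sets of the norm only.
\<close>

lemma proper_continuous_map_Euclidean_space_iff:
  "proper_continuous_map Y (Euclidean_space m) f \<longleftrightarrow>
    continuous_map Y (Euclidean_space m) f \<and> (\<forall>M. compactin Y {y \<in> topspace Y. l1 m (f y) \<le> M})"
proof (intro iffI conjI allI)
  assume f: "proper_continuous_map Y (Euclidean_space m) f"
  then show c: "continuous_map Y (Euclidean_space m) f" by (simp add: proper_continuous_map_def)
  fix M
  have eq: "{y \<in> topspace Y. l1 m (f y) \<le> M} =
        {y \<in> topspace Y. f y \<in> {v \<in> topspace (Euclidean_space m). l1 m v \<le> M}}"
    using continuous_map_funspace[OF c] by auto
  show "compactin Y {y \<in> topspace Y. l1 m (f y) \<le> M}"
    unfolding eq using f compactin_l1_ball[of m M] unfolding proper_continuous_map_def by blast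
next
  assume f: "continuous_map Y (Euclidean_space m) f \<and> (\<forall>M. compactin Y {y \<in> topspace Y. l1 m (f y) \<le> M})"
  show "proper_continuous_map Y (Euclidean_space m) f"
    unfolding proper_continuous_map_def
  proof (intro conjI allI impI)
    fix C assume C: "compactin (Euclidean_space m) C"
    have "continuous_map (Euclidean_space m) euclideanreal (l1 m)"
      using continuous_map_l1[of m "Euclidean_space m" "\<lambda>v. v"]
        continuous_map_Euclidean_space_component[OF continuous_map_id] by (simp add: id_def)
    from image_compactin[OF C this] have "bdd_above (l1 m ` C)"
      by (simp add: bounded_imp_bdd_above compact_imp_bounded)
    then obtain M where "\<And>v. v \<in> C \<Longrightarrow> l1 m v \<le> M"
      unfolding bdd_above_def by blast
    then have "{y \<in> topspace Y. f y \<in> C} \<subseteq> {y \<in> topspace Y. l1 m (f y) \<le> M}" by auto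
    moreover have "closedin Y {y \<in> topspace Y. f y \<in> C}"
      using f compactin_imp_closedin[OF Hausdorff_Euclidean_space C]
      by (intro closedin_continuous_map_preimage) auto
    ultimately show "compactin Y {y \<in> topspace Y. f y \<in> C}"
      using f closed_compactin by blast
  qed (use f in simp)
qed

section \<open>The remainder of a locally compact Lindelof space\<close>

lemma continuous_map_suminf:
  fixes f :: "nat \<Rightarrow> 'a \<Rightarrow> real"
  assumes f: "\<And>k. continuous_map Y euclideanreal (f k)"
    and M: "\<And>k y. y \<in> topspace Y \<Longrightarrow> \<bar>f k y\<bar> \<le> M k" "summable M"
  shows "continuous_map Y euclideanreal (\<lambda>y. \<Sum>k. f k y)"
proof -
  have "uniform_limit (topspace Y) (\<lambda>n y. \<Sum>k<n. f k y) (\<lambda>y. \<Sum>k. f k y) sequentially"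
    using M by (intro Weierstrass_m_test) auto
  moreover have "continuous_map Y euclideanreal (\<lambda>y. \<Sum>k<n. f k y)" for n
    by (intro continuous_intros f) auto
  ultimately have "continuous_map Y Met_TC.mtopology (\<lambda>y. \<Sum>k. f k y)"
    by (intro Met_TC.continuous_map_uniform_limit_alt[where F = sequentially and f = "\<lambda>n y. \<Sum>k<n. f k y"])
      (auto simp: uniform_limit_iff)
  then show ?thesis by simp
qed

lemma closed_preimage_closure_of:
  assumes "continuous_map Y euclideanreal u" "closed D" "\<And>z. z \<in> S \<Longrightarrow> u z \<in> D"
    "y \<in> Y closure_of S"
  shows "u y \<in> D"
proof -
  have "continuous_map Y euclideanreal u \<Longrightarrow> u ` (Y closure_of S) \<subseteq> euclideanreal closure_of (u ` S)"
    by (rule continuous_map_image_closure_subset)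
  then have "u y \<in> closure (u ` S)" using assms(1,4) by auto
  then show ?thesis using closure_minimal[of "u ` S" D] assms(2,3) by auto
qed

text \<open>
  The space \<open>X\<close> of the theorem is fixed, with short names for its compactification \<open>B\<close>, the embedding
  \<open>e\<close> and the remainder \<open>R\<close>, which is handled as a subset of \<open>B\<close>.
\<close>

locale locally_compact_Lindelof =
  fixes X :: "'a topology"
  assumes tychonoff: "tychonoff_space X"
    and locally_compact: "locally_compact_space X"
    and Lindelof: "Lindelof_space X"
begin

abbreviation "B \<equiv> stone_cech X"
abbreviation "e \<equiv> stone_cech_embedding X"
abbreviation "R \<equiv> topspace B - e ` topspace X"

lemma normal_B: "normal_space B"
  using compact_space_stone_cech Hausdorff_space_stone_cech
  by (blast intro: compact_Hausdorff_or_regular_imp_normal_space)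

lemma normal_X: "normal_space X"
  using tychonoff Lindelof unfolding tychonoff_space_def
  by (blast intro: regular_Lindelof_imp_normal_space completely_regular_imp_regular_space)

lemma homeomorphic_e: "homeomorphic_map X (subtopology B (e ` topspace X)) e"
  using embedding_map_stone_cech[OF tychonoff] by (simp add: embedding_map_def)

lemma continuous_e: "continuous_map X B e"
  using homeomorphic_imp_continuous_map[OF homeomorphic_e] continuous_map_in_subtopology by blast

lemma e_in: "x \<in> topspace X \<Longrightarrow> e x \<in> topspace B"
  using continuous_map_funspace[OF continuous_e] by auto

lemma continuous_e_compose:
  "continuous_map B euclideanreal u \<Longrightarrow> continuous_map X euclideanreal (\<lambda>x. u (e x))"
  using continuous_map_compose[OF continuous_e] by (fastforce simp: o_def)

text \<open>
  A dense locally compact subspace of a Hausdorff space is open.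
\<close>

lemma closedin_R: "closedin B R"
proof -
  have "locally_compact_space (subtopology B (e ` topspace X))"
    using homeomorphic_locally_compact_space[of X] homeomorphic_map_imp_homeomorphic_space[OF homeomorphic_e]
      locally_compact by blast
  then have "openin B (e ` topspace X)"
    using e_in by (intro dense_locally_compact_openin_Hausdorff_space Hausdorff_space_stone_cech
        stone_cech_dense) auto
  then show ?thesis by blast
qed

lemma remainder_eq: "stone_cech_remainder X = subtopology B R"
  by (simp add: stone_cech_remainder_def)

lemma topspace_remainder: "topspace (stone_cech_remainder X) = R"
  by (auto simp: remainder_eq)

lemma compactin_preimage:
  assumes "closedin B T" "T \<inter> R = {}"
  shows "compactin X {x \<in> topspace X. e x \<in> T}"
proof -
  have T: "T \<subseteq> e ` topspace X" using assms closedin_subset by blast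
  then have "e ` {x \<in> topspace X. e x \<in> T} = T" by blast
  moreover have "compactin (subtopology B (e ` topspace X)) T"
    using closedin_compact_space[OF compact_space_stone_cech assms(1)] T
    by (simp add: compactin_subtopology)
  ultimately show ?thesis
    using homeomorphic_map_compactness_eq[OF homeomorphic_e, of "{x \<in> topspace X. e x \<in> T}"] by auto
qed

text \<open>
  Points of the remainder see \<open>X\<close> only at infinity: if such a point is in the closure of \<open>A\<close>, then it
  remains so after removing a compact set, whose image is closed in \<open>B\<close>. Closed conditions that
  hold on \<open>A\<close> outside a compact set therefore pass to the limit.
\<close>

lemma limit_on_remainder:
  assumes u: "continuous_map B euclideanreal u" and D: "closed D"
    and y: "y \<in> R" "y \<in> B closure_of (e ` A)" and C: "compactin X C"
    and uD: "\<And>x. x \<in> A - C \<Longrightarrow> u (e x) \<in> D"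
  shows "u y \<in> D"
proof -
  have "closedin B (e ` C)"
    by (rule compactin_imp_closedin[OF Hausdorff_space_stone_cech image_compactin[OF C continuous_e]])
  then have "B closure_of (e ` C) = e ` C" by (simp add: closure_of_closedin)
  moreover have "C \<subseteq> topspace X" using C compactin_subset_topspace by blast
  ultimately have "y \<notin> B closure_of (e ` C)" using y(1) by auto
  moreover have "e ` A \<subseteq> e ` (A - C) \<union> e ` C" by blast
  then have "B closure_of (e ` A) \<subseteq> B closure_of (e ` (A - C)) \<union> B closure_of (e ` C)"
    unfolding closure_of_Un[symmetric] by (rule closure_of_mono)
  ultimately have "y \<in> B closure_of (e ` (A - C))" using y(2) by blast
  then show ?thesis
    by (rule closed_preimage_closure_of[OF u D, rotated]) (use uD in blast)
qed

text \<open>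
  The extension property for maps into \<open>[0,1]\<close>, transported to \<open>[-1,1]\<close>.
\<close>

lemma bounded_extension:
  assumes h: "continuous_map X euclideanreal h" "\<And>x. x \<in> topspace X \<Longrightarrow> \<bar>h x\<bar> \<le> 1"
  obtains H where "continuous_map B euclideanreal H" "\<And>x. x \<in> topspace X \<Longrightarrow> H (e x) = h x"
proof -
  have "continuous_map X euclideanreal (\<lambda>x. (h x + 1) / 2)"
    by (intro continuous_map_real_divide continuous_map_add h(1)) auto
  moreover have "(h x + 1) / 2 \<in> {0..1}" if "x \<in> topspace X" for x
    using h(2)[OF that] by (auto simp: abs_le_iff)
  ultimately have "continuous_map X (top_of_set {0..1}) (\<lambda>x. (h x + 1) / 2)"
    by (simp add: continuous_map_in_subtopology Pi_iff)
  then obtain g where g: "continuous_map B (top_of_set {0..1}) g"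
      "\<And>x. x \<in> topspace X \<Longrightarrow> g (e x) = (h x + 1) / 2"
    using stone_cech_extension by blast
  show ?thesis
  proof
    show "continuous_map B euclideanreal (\<lambda>y. 2 * g y - 1)"
      using g(1) by (intro continuous_intros) (simp add: continuous_map_in_subtopology)
    show "2 * g (e x) - 1 = h x" if "x \<in> topspace X" for x
      using g(2)[OF that] by simp
  qed
qed

text \<open>
  Each point of \<open>X\<close> is separated from the closed set \<open>R\<close> by a Urysohn function that vanishes on
  \<open>R\<close>. By the Lindelof property countably many of these have no common zero in \<open>X\<close>, and \<open>q\<close> is
  a weighted sum of them. On \<open>X\<close>, the function \<open>1 / q\<close> is proper.
\<close>

lemma remainder_zero_set:
  obtains q where "continuous_map B euclideanreal q" "\<And>y. y \<in> R \<Longrightarrow> q y = 0" "\<And>x. x \<in> topspace X \<Longrightarrow> 0 < q (e x)"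
proof -
  have "\<exists>f. continuous_map B (top_of_set {0..1::real}) f \<and> f ` R \<subseteq> {0} \<and> f (e x) = 1"
    if x: "x \<in> topspace X" for x
  proof -
    have cl: "closedin B {e x}"
      by (rule closedin_Hausdorff_singleton[OF Hausdorff_space_stone_cech e_in[OF x]])
    have dj: "disjnt R {e x}" using x by (auto simp: disjnt_def)
    obtain f :: "_ \<Rightarrow> real" where "continuous_map B (top_of_set {0..1}) f" "f ` R \<subseteq> {0}" "f ` {e x} \<subseteq> {1}"
      using Urysohn_lemma[OF normal_B closedin_R cl dj zero_le_one] by blast
    then show ?thesis by (intro exI[of _ f]) simp
  qed
  then obtain f where f: "\<And>x. x \<in> topspace X \<Longrightarrow> continuous_map B (top_of_set {0..1::real}) (f x)"
    "\<And>x y. x \<in> topspace X \<Longrightarrow> y \<in> R \<Longrightarrow> f x y = 0" "\<And>x. x \<in> topspace X \<Longrightarrow> f x (e x) = 1"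
    unfolding image_subset_iff singleton_iff by metis
  have fc: "continuous_map B euclideanreal (f x)" if "x \<in> topspace X" for x
    using f(1)[OF that] by (simp add: continuous_map_in_subtopology)
  have f01: "0 \<le> f x y \<and> f x y \<le> 1" if "x \<in> topspace X" "y \<in> topspace B" for x y
    using continuous_map_funspace[OF f(1)[OF that(1)]] that(2) by auto
  define N where "N x = {z \<in> topspace X. f x (e z) \<in> {0<..}}" for x
  have "openin X (N x)" if "x \<in> topspace X" for x
    unfolding N_def
    by (rule openin_continuous_map_preimage[OF continuous_e_compose[OF fc[OF that]]]) auto
  moreover have "x \<in> N x" if "x \<in> topspace X" for x using that f(3) by (simp add: N_def)
  then have "\<Union>(N ` topspace X) = topspace X" by (auto simp: N_def)
  ultimately obtain \<V> where V: "countable \<V>" "\<V> \<subseteq> N ` topspace X" "\<Union>\<V> = topspace X"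
    using Lindelof unfolding Lindelof_space_def by (metis (no_types, lifting) imageE)
  then obtain S where S: "countable S" "S \<subseteq> topspace X" "\<V> = N ` S"
    using countable_subset_image[of \<V> N "topspace X"] by auto
  show ?thesis
  proof (cases "S = {}")
    case True
    then have "topspace X = {}" using V S by simp
    then show ?thesis by (intro that[of "\<lambda>_. 0"]) auto
  next
    case False
    define s where "s = from_nat_into S"
    have s: "range s = S" using S(1) False by (simp add: s_def range_from_nat_into)
    then have sX: "s k \<in> topspace X" for k using S(2) by blast
    define q where "q y = (\<Sum>k. (1 / 2) ^ k * f (s k) y)" for y
    have bound: "\<bar>(1 / 2) ^ k * f (s k) y\<bar> \<le> (1 / 2) ^ k" if "y \<in> topspace B" for k y
      using f01[OF sX that, of k] by (simp add: abs_mult mult_left_le)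
    have sm: "summable (\<lambda>k. (1 / 2 :: real) ^ k)" by (intro summable_geometric) simp
    have sumq: "summable (\<lambda>k. (1 / 2) ^ k * f (s k) y)" if "y \<in> topspace B" for y
      using bound[OF that] by (intro summable_comparison_test'[OF sm, of 0]) simp
    have nn: "0 \<le> (1 / 2) ^ k * f (s k) y" if "y \<in> topspace B" for k y
      using f01[OF sX that] by simp
    show ?thesis
    proof
      show "continuous_map B euclideanreal q"
        unfolding q_def by (rule continuous_map_suminf[OF _ bound sm]) (intro continuous_intros fc sX)
      show "q y = 0" if "y \<in> R" for y
        using f(2)[OF sX that] by (simp add: q_def)
      show "0 < q (e x)" if x: "x \<in> topspace X" for x
      proof -
        obtain z where "z \<in> S" "x \<in> N z" using x V(3) S(3) by blast
        then obtain k where "x \<in> N (s k)" using s by blast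
        then have "0 < (1 / 2) ^ k * f (s k) (e x)" by (simp add: N_def)
        then show ?thesis
          unfolding q_def using suminf_pos2[OF sumq nn] e_in[OF x] by blast
      qed
    qed
  qed
qed

lemma bounded_extension_family:
  fixes h :: "'a \<Rightarrow> nat \<Rightarrow> real"
  assumes "\<And>i. i < m \<Longrightarrow> continuous_map X euclideanreal (\<lambda>x. h x i)"
    "\<And>i x. i < m \<Longrightarrow> x \<in> topspace X \<Longrightarrow> \<bar>h x i\<bar> \<le> 1"
  obtains H where "\<And>i. i < m \<Longrightarrow> continuous_map B euclideanreal (\<lambda>y. H y i)"
    "\<And>i x. i < m \<Longrightarrow> x \<in> topspace X \<Longrightarrow> H (e x) i = h x i"
proof -
  have "\<exists>g. continuous_map B euclideanreal g \<and> (\<forall>x\<in>topspace X. g (e x) = h x i)" if "i < m" for i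
    by (rule bounded_extension[OF assms(1)[OF that] assms(2)[OF that]]) (assumption | blast)+
  then obtain g where g: "\<And>i. i < m \<Longrightarrow> continuous_map B euclideanreal (g i)"
    "\<And>i x. i < m \<Longrightarrow> x \<in> topspace X \<Longrightarrow> g i (e x) = h x i"
    by metis
  show ?thesis by (rule that[of "\<lambda>y i. g i y"]) (use g in auto)
qed

lemma topspace_subset_closure: "topspace B \<subseteq> B closure_of (e ` topspace X)"
  by (simp add: stone_cech_dense)

section \<open>From proper extensions to the dimension of the remainder\<close>

text \<open>
  Let \<open>F'\<close> be an extension of \<open>F\<close> to \<open>B\<close> and \<open>A\<close> the part of \<open>X\<close> where its norm is at least
  \<open>\<epsilon> / 2\<close>. The map \<open>f = F' / q\<close> is proper on \<open>A\<close> since \<open>q\<close> vanishes on the remainder. For a proper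
  extension \<open>g\<close> of \<open>f\<close>, the map \<open>g / max 1 \<bar>g\<bar>\<close> is bounded, so it extends to a map \<open>H\<close> on \<open>B\<close>. On the
  remainder \<open>H\<close> has norm one, and it points in the direction of \<open>F\<close> wherever \<open>\<bar>F\<bar> \<ge> \<epsilon>\<close>, because
  the factor \<open>1 / q\<close> does not change directions. Rescaling \<open>H\<close> to norm \<open>max \<epsilon> \<bar>F\<bar>\<close> gives the result.
\<close>

lemma proper_dim_le_imp_nonvanishing_extension:
  assumes dim: "proper_dim_le X m"
  shows "nonvanishing_extension (stone_cech_remainder X) m"
  unfolding nonvanishing_extension_def topspace_remainder
proof (intro allI impI, elim conjE)
  fix F :: "_ \<Rightarrow> nat \<Rightarrow> real" and \<epsilon> :: real
  assume F: "\<forall>i<m. continuous_map (stone_cech_remainder X) euclideanreal (\<lambda>y. F y i)" and "0 < \<epsilon>"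
  obtain q where q: "continuous_map B euclideanreal q" "\<And>y. y \<in> R \<Longrightarrow> q y = 0" "\<And>x. x \<in> topspace X \<Longrightarrow> 0 < q (e x)"
    by (rule remainder_zero_set) (rule that)
  obtain F' where F': "\<And>i. i < m \<Longrightarrow> continuous_map B euclideanreal (\<lambda>y. F' y i)"
    "\<And>i y. i < m \<Longrightarrow> y \<in> R \<Longrightarrow> F' y i = F y i"
    by (rule Tietze_family[OF normal_B closedin_R is_interval_univ UNIV_not_empty, of m F])
      (use F in \<open>simp add: remainder_eq\<close>, rule UNIV_I, rule that)
  have cF': "continuous_map B euclideanreal (\<lambda>y. l1 m (F' y))"
    by (intro continuous_intros F')
  have F'F: "l1 m (F' y) = l1 m (F y)" if "y \<in> R" for y
    using F'(2) that by (intro l1_cong) auto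
  define A where "A = {x \<in> topspace X. \<epsilon> / 2 \<le> l1 m (F' (e x))}"
  have clA: "closedin X A"
    unfolding A_def by (intro closedin_le continuous_e_compose cF') simp
  define f where "f x = (\<lambda>i. if i < m then F' (e x) i / q (e x) else 0)" for x
  have l1f: "l1 m (f x) = l1 m (F' (e x)) / q (e x)" if "x \<in> topspace X" for x
  proof -
    have "l1 m (f x) = l1 m (\<lambda>i. F' (e x) i / q (e x))" by (intro l1_cong) (simp add: f_def)
    then show ?thesis using q(3)[OF that] by (simp add: l1_divide)
  qed
  have fprop: "proper_continuous_map (subtopology X A) (Euclidean_space m) f"
    unfolding proper_continuous_map_Euclidean_space_iff
  proof (intro conjI allI)
    have "continuous_map X euclideanreal (\<lambda>x. F' (e x) i / q (e x))" if "i < m" for i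
    proof (intro continuous_map_real_divide continuous_e_compose q(1) F'(1) that)
      show "q (e x) \<noteq> 0" if "x \<in> topspace X" for x using q(3)[OF that] by simp
    qed
    then show "continuous_map (subtopology X A) (Euclidean_space m) f"
      unfolding f_def continuous_map_componentwise_Euclidean_space
      by (blast intro: continuous_map_from_subtopology)
  next
    fix M
    \<comment> \<open>The sublevel set is the trace on \<open>X\<close> of a closed subset of \<open>B\<close> that misses the remainder.\<close>
    define T where "T = {y \<in> topspace B. \<epsilon> / 2 \<le> l1 m (F' y)} \<inter> {y \<in> topspace B. l1 m (F' y) \<le> M * q y}"
    have "closedin B T"
      unfolding T_def by (intro closedin_Int closedin_le cF' continuous_map_real_mult_left q(1)) simp
    moreover have "T \<inter> R = {}"
      using q(2) \<open>0 < \<epsilon>\<close> by (force simp: T_def)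
    ultimately have "compactin X {x \<in> topspace X. e x \<in> T}" by (rule compactin_preimage)
    moreover have "{x \<in> topspace X. e x \<in> T} = {x \<in> topspace (subtopology X A). l1 m (f x) \<le> M}"
    proof -
      have "e x \<in> T \<longleftrightarrow> x \<in> A \<and> l1 m (f x) \<le> M" if "x \<in> topspace X" for x
        using that e_in[OF that] q(3)[OF that] by (simp add: T_def A_def l1f pos_divide_le_eq)
      then show ?thesis by auto
    qed
    ultimately show "compactin (subtopology X A) {x \<in> topspace (subtopology X A). l1 m (f x) \<le> M}"
      by (auto simp: compactin_subtopology)
  qed
  obtain g where g: "proper_continuous_map X (Euclidean_space m) g" "\<And>x. x \<in> A \<Longrightarrow> g x = f x"
    using dim clA fprop unfolding proper_dim_le_def by blast
  have cg: "continuous_map X euclideanreal (\<lambda>x. g x i)" for i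
    using g(1) unfolding proper_continuous_map_def by (blast intro: continuous_map_Euclidean_space_component)
  define k where "k x i = g x i / max 1 (l1 m (g x))" for x i
  have "continuous_map X euclideanreal (\<lambda>x. k x i)" if "i < m" for i
    unfolding k_def
    by (intro continuous_map_real_divide continuous_map_real_max continuous_map_l1 cg) auto
  moreover have "\<bar>k x i\<bar> \<le> 1" if "i < m" for i x
    using abs_le_l1[OF that, of "g x"] by (simp add: k_def)
  ultimately obtain H where H: "\<And>i. i < m \<Longrightarrow> continuous_map B euclideanreal (\<lambda>y. H y i)"
    "\<And>i x. i < m \<Longrightarrow> x \<in> topspace X \<Longrightarrow> H (e x) i = k x i"
    by (rule bounded_extension_family[of m k]) (assumption, assumption, rule that)
  define C where "C = {x \<in> topspace X. l1 m (g x) \<le> 1}"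
  have C: "compactin X C"
    using g(1) unfolding C_def proper_continuous_map_Euclidean_space_iff by blast
  have l1H: "l1 m (H y) = 1" if y: "y \<in> R" for y
  proof -
    have out: "l1 m (H (e x)) \<in> {1}" if x: "x \<in> topspace X - C" for x
    proof -
      have "l1 m (H (e x)) = l1 m (\<lambda>i. g x i / max 1 (l1 m (g x)))"
        using x H(2) by (intro l1_cong) (auto simp: k_def)
      then show ?thesis using x by (auto simp: l1_divide C_def max_def)
    qed
    have cH: "continuous_map B euclideanreal (\<lambda>y. l1 m (H y))" by (intro continuous_intros H)
    have "y \<in> B closure_of (e ` topspace X)" using topspace_subset_closure y by blast
    from limit_on_remainder[OF cH closed_singleton y this C out] have "l1 m (H y) \<in> {1}" .
    then show ?thesis by simp
  qed
  have HF: "H y i * l1 m (F y) = F y i" if y: "y \<in> R" "\<epsilon> \<le> l1 m (F y)" and i: "i < m" for y i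
  proof -
    \<comment> \<open>The slack between \<open>\<epsilon> / 2\<close> and \<open>\<epsilon>\<close> places \<open>y\<close> in the closure of \<open>A\<close>.\<close>
    have "y \<in> B closure_of (e ` A)"
      unfolding in_closure_of
    proof (intro conjI allI impI)
      show "y \<in> topspace B" using y by simp
      fix V assume V: "y \<in> V \<and> openin B V"
      have "openin B {z \<in> topspace B. l1 m (F' z) \<in> {\<epsilon> / 2<..}}"
        by (rule openin_continuous_map_preimage[OF cF']) auto
      then have "openin B (V \<inter> {z \<in> topspace B. l1 m (F' z) \<in> {\<epsilon> / 2<..}})" (is "openin B ?V")
        using V by blast
      moreover have "y \<in> ?V"
        using V y F'F[OF y(1)] \<open>0 < \<epsilon>\<close> by auto
      ultimately have nbhd: "y \<in> ?V \<and> openin B ?V" by (rule conjI [rotated])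
      have "y \<in> B closure_of (e ` topspace X)" using y topspace_subset_closure by blast
      then have "\<forall>T. y \<in> T \<and> openin B T \<longrightarrow> (\<exists>z. z \<in> e ` topspace X \<and> z \<in> T)"
        unfolding in_closure_of by (rule conjunct2)
      from this [THEN spec, THEN mp, OF nbhd] have "\<exists>z. z \<in> e ` topspace X \<and> z \<in> ?V" .
      then show "\<exists>z. z \<in> e ` A \<and> z \<in> V" by (force simp: A_def)
    qed
    note ycl = this
    have out: "H (e x) i * l1 m (F' (e x)) - F' (e x) i \<in> {0}" if x: "x \<in> A - C" for x
    proof -
      have xX: "x \<in> topspace X" using x by (simp add: A_def)
      have "1 < l1 m (g x)" using x xX by (auto simp: C_def)
      then have "k x i = f x i / l1 m (f x)" using g(2) x by (simp add: k_def)
      also have "\<dots> = F' (e x) i / l1 m (F' (e x))"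
        using l1f[OF xX] q(3)[OF xX] i by (simp add: f_def)
      finally have "H (e x) i = F' (e x) i / l1 m (F' (e x))" using H(2)[OF i xX] by simp
      moreover have "0 < l1 m (F' (e x))" using x \<open>0 < \<epsilon>\<close> by (auto simp: A_def)
      ultimately show ?thesis by simp
    qed
    have "continuous_map B euclideanreal (\<lambda>y. H y i * l1 m (F' y) - F' y i)"
      by (intro continuous_intros H F' cF' i)
    from limit_on_remainder[OF this closed_singleton y(1) ycl C out]
    have "H y i * l1 m (F' y) - F' y i \<in> {0}" .
    then show ?thesis using F'F[OF y(1)] F'(2)[OF i y(1)] by simp
  qed
  define G where "G y i = max \<epsilon> (l1 m (F' y)) * H y i" for y i
  show "\<exists>G. (\<forall>i<m. continuous_map (stone_cech_remainder X) euclideanreal (\<lambda>x. G x i)) \<and>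
      (\<forall>x\<in>R. 0 < l1 m (G x) \<and> (\<epsilon> \<le> l1 m (F x) \<longrightarrow> (\<forall>i<m. G x i = F x i)))"
  proof (intro exI[of _ G] conjI allI impI ballI)
    show "continuous_map (stone_cech_remainder X) euclideanreal (\<lambda>y. G y i)" if "i < m" for i
      unfolding remainder_eq G_def
      by (intro continuous_map_from_subtopology continuous_map_real_mult continuous_map_real_max cF' H that) simp
    fix y assume y: "y \<in> R"
    show "0 < l1 m (G y)"
      using l1H[OF y] \<open>0 < \<epsilon>\<close> unfolding G_def l1_scale by auto
    show "G y i = F y i" if "\<epsilon> \<le> l1 m (F y)" "i < m" for i
      using HF[OF y that] that(1) F'F[OF y] by (simp add: G_def mult.commute)
  qed
qed

section \<open>From the dimension of the remainder to proper extensions\<close>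

text \<open>
  With \<open>N = max 1 \<bar>f\<bar>\<close>, the given proper map \<open>f\<close> on \<open>A\<close> is the quotient of the bounded maps
  \<open>f / N\<close> and \<open>1 / N\<close>. The numerator extends to a map \<open>P\<close> on \<open>B\<close> without zeros on the remainder; this
  is where the dimension enters. The denominator extends to a positive function \<open>d\<close> on \<open>X\<close> that tends to
  zero at the remainder. Then \<open>P / d\<close> extends \<open>f\<close>, and it is proper because \<open>\<bar>P\<bar> \<le> M d\<close> cannot
  hold near the remainder.
\<close>

lemma covering_dim_le_imp_proper_dim_le:
  assumes dim: "covering_dim_le (stone_cech_remainder X) n"
  shows "proper_dim_le X (n + 1)"
  unfolding proper_dim_le_def
proof (intro allI impI, elim conjE)
  define m where "m = n + 1"
  fix A and f :: "'a \<Rightarrow> nat \<Rightarrow> real"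
  assume clA: "closedin X A"
    and "proper_continuous_map (subtopology X A) (Euclidean_space (n + 1)) f"
  then have f: "proper_continuous_map (subtopology X A) (Euclidean_space m) f" by (simp add: m_def)
  have AX: "A \<subseteq> topspace X" using clA closedin_subset by blast
  then have tA: "topspace (subtopology X A) = A" by auto
  have cf: "continuous_map (subtopology X A) euclideanreal (\<lambda>x. f x i)" for i
    using f unfolding proper_continuous_map_def by (blast intro: continuous_map_Euclidean_space_component)
  have f0: "f x i = 0" if "x \<in> A" "\<not> i < m" for x i
  proof -
    have "f x \<in> topspace (Euclidean_space m)"
      using f that(1) tA continuous_map_funspace[of "subtopology X A" _ f]
      unfolding proper_continuous_map_def by fastforce
    then show ?thesis using that(2) by (simp add: topspace_Euclidean_space)
  qed
  have compf: "compactin X {x \<in> A. l1 m (f x) \<le> M}" for M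
    using f unfolding proper_continuous_map_Euclidean_space_iff tA compactin_subtopology by blast
  define N where "N x = max 1 (l1 m (f x))" for x
  have cN: "continuous_map (subtopology X A) euclideanreal N"
    unfolding N_def by (intro continuous_intros cf)
  have N1: "1 \<le> N x" for x by (simp add: N_def)
  then have N0: "N x \<noteq> 0" for x by (metis not_one_le_zero)
  obtain q where q: "continuous_map B euclideanreal q" "\<And>y. y \<in> R \<Longrightarrow> q y = 0" "\<And>x. x \<in> topspace X \<Longrightarrow> 0 < q (e x)"
    by (rule remainder_zero_set) (rule that)

  define h where "h x i = f x i / N x" for x i
  have ch: "continuous_map (subtopology X A) euclideanreal (\<lambda>x. h x i)" for i
    unfolding h_def by (intro continuous_map_real_divide cf cN N0)
  have h1: "h x i \<in> {-1..1}" if "i < m" for x i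
  proof -
    have "\<bar>f x i\<bar> \<le> N x" using abs_le_l1[OF that, of "f x"] by (simp add: N_def)
    then have "\<bar>h x i\<bar> \<le> 1" using N1[of x] by (simp add: h_def)
    then show ?thesis by (simp add: abs_le_iff minus_le_iff)
  qed
  obtain h' where h': "\<And>i. i < m \<Longrightarrow> continuous_map X euclideanreal (\<lambda>x. h' x i)"
    "\<And>i x. i < m \<Longrightarrow> x \<in> topspace X \<Longrightarrow> h' x i \<in> {-1..1}" "\<And>i x. i < m \<Longrightarrow> x \<in> A \<Longrightarrow> h' x i = h x i"
    by (rule Tietze_family[OF normal_X clA is_interval_cc, of "-1" 1 m h])
      (simp, rule ch, rule h1, assumption, rule that)
  have h'1: "\<bar>h' x i\<bar> \<le> 1" if "i < m" "x \<in> topspace X" for i x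
    using h'(2)[OF that] by auto
  obtain H where H: "\<And>i. i < m \<Longrightarrow> continuous_map B euclideanreal (\<lambda>y. H y i)"
    "\<And>i x. i < m \<Longrightarrow> x \<in> topspace X \<Longrightarrow> H (e x) i = h' x i"
    by (rule bounded_extension_family[of m h'])
      (rule h'(1), assumption, rule h'1, assumption, assumption, rule that)
  have HA: "H (e x) i = f x i / N x" if "x \<in> A" "i < m" for x i
    using that AX H(2) h'(3) by (auto simp: h_def)
  have cH: "continuous_map B euclideanreal (\<lambda>y. l1 m (H y))" by (intro continuous_intros H)

  have c1N: "continuous_map (subtopology X A) euclideanreal (\<lambda>x. 1 / N x)"
    by (intro continuous_map_real_divide cN N0) auto
  have "1 / N x \<in> {0..1}" for x using N1[of x] by simp
  then have im: "(\<lambda>x. 1 / N x) ` A \<subseteq> {0..1}" by blast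
  obtain s' where s': "continuous_map X euclideanreal s'" "s' ` topspace X \<subseteq> {0..1}"
    "\<And>x. x \<in> A \<Longrightarrow> s' x = 1 / N x"
    by (rule Tietze_extension_realinterval[OF normal_X clA is_interval_cc _ c1N im]) (simp, rule that)
  have s'1: "\<bar>s' x\<bar> \<le> 1" if "x \<in> topspace X" for x using s'(2) that by fastforce
  obtain s where s: "continuous_map B euclideanreal s" "\<And>x. x \<in> topspace X \<Longrightarrow> s (e x) = s' x"
    by (rule bounded_extension[OF s'(1) s'1]) (assumption, rule that)

  define cA where "cA = B closure_of (e ` A)"
  have clcA: "closedin B cA" by (simp add: cA_def)
  have AcA: "e x \<in> cA" if "x \<in> A" for x
    using that AX e_in closure_of_subset[of "e ` A" B] unfolding cA_def by blast
  \<comment> \<open>At the points of the remainder adherent to \<open>A\<close>, the map \<open>f\<close> is infinitely large.\<close>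
  have l1H: "l1 m (H y) = 1" if y: "y \<in> R" "y \<in> cA" for y
  proof -
    have out: "l1 m (H (e x)) \<in> {1}" if x: "x \<in> A - {x \<in> A. l1 m (f x) \<le> 1}" for x
    proof -
      have "l1 m (H (e x)) = l1 m (\<lambda>i. f x i / N x)"
        using x HA by (intro l1_cong) auto
      then show ?thesis using x by (auto simp: l1_divide N_def max_def)
    qed
    from limit_on_remainder[OF cH closed_singleton y(1) y(2)[unfolded cA_def] compf out]
    have "l1 m (H y) \<in> {1}" .
    then show ?thesis by simp
  qed
  have s0: "s y = 0" if y: "y \<in> R" "y \<in> cA" for y
  proof -
    have s\<delta>: "s y \<in> {0..\<delta>}" if "0 < \<delta>" for \<delta>
    proof (rule limit_on_remainder[OF s(1) _ y(1) _ compf[of "1 / \<delta>"], of "{0..\<delta>}" A])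
      show "y \<in> B closure_of (e ` A)" using y(2) by (simp add: cA_def)
      fix x assume x: "x \<in> A - {x \<in> A. l1 m (f x) \<le> 1 / \<delta>}"
      then have "1 / \<delta> < N x" by (auto simp: N_def)
      then have "1 / N x \<le> \<delta>" using \<open>0 < \<delta>\<close> N1[of x] by (simp add: divide_simps mult.commute)
      moreover have "s (e x) = 1 / N x" using x AX s(2) s'(3) by auto
      ultimately show "s (e x) \<in> {0..\<delta>}" using N1[of x] by simp
    qed simp
    have "s y \<le> 0" by (rule field_le_epsilon) (use s\<delta> in auto)
    then show ?thesis using s\<delta>[of 1] by simp
  qed

  \<comment> \<open>\<open>P\<close> is \<open>H\<close> on the closure of \<open>A\<close>. Towards the part \<open>Z\<close> of the remainder where \<open>H\<close> is small it
    is deformed linearly into the approximation \<open>G\<close>; outside \<open>Z\<close> the norm of \<open>H\<close> exceeds the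
    distance from \<open>H\<close> to \<open>G\<close>, so that the deformation does not meet the origin.\<close>
  have comp: "compact_space (stone_cech_remainder X)"
    unfolding remainder_eq
    using closedin_compact_space[OF compact_space_stone_cech closedin_R] by (rule compact_space_subtopology)
  have cHR: "continuous_map (stone_cech_remainder X) euclideanreal (\<lambda>y. H y i)" if "i < n + 1" for i
    using that H(1) unfolding remainder_eq m_def by (intro continuous_map_from_subtopology) auto
  have "0 < (1 / 2 :: real)" by simp
  from covering_dim_le_imp_nonvanishing_approximation[of _ _ H, OF comp dim cHR this]
  obtain G where G: "\<And>i. i < m \<Longrightarrow> continuous_map (subtopology B R) euclideanreal (\<lambda>y. G y i)"
    "\<And>y. y \<in> R \<Longrightarrow> l1 m (\<lambda>i. G y i - H y i) < 1 / 2" "\<And>y. y \<in> R \<Longrightarrow> 0 < l1 m (G y)"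
    unfolding topspace_remainder remainder_eq [symmetric] m_def [symmetric] by blast
  obtain G' where G': "\<And>i. i < m \<Longrightarrow> continuous_map B euclideanreal (\<lambda>y. G' y i)"
    "\<And>i y. i < m \<Longrightarrow> y \<in> R \<Longrightarrow> G' y i = G y i"
    by (rule Tietze_family[OF normal_B closedin_R is_interval_univ UNIV_not_empty, of m G])
      (rule G(1), assumption, rule UNIV_I, rule that)
  define Z where "Z = R \<inter> {y \<in> topspace B. l1 m (H y) \<le> 1 / 2}"
  have "closedin B Z" unfolding Z_def by (intro closedin_Int closedin_R closedin_le cH) simp
  moreover have "disjnt Z cA" using l1H by (auto simp: Z_def disjnt_def)
  ultimately obtain w :: "_ \<Rightarrow> real" where w: "continuous_map B (top_of_set {0..1}) w" "w ` Z \<subseteq> {0}" "w ` cA \<subseteq> {1}"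
    using Urysohn_lemma[OF normal_B _ clcA _ zero_le_one] by blast
  have cw: "continuous_map B euclideanreal w" using w(1) by (simp add: continuous_map_in_subtopology)
  have w01: "0 \<le> w y" "w y \<le> 1" if "y \<in> topspace B" for y
    using continuous_map_funspace[OF w(1)] that by auto
  define P where "P y i = G' y i + w y * (H y i - G' y i)" for y i
  have cPi: "continuous_map B euclideanreal (\<lambda>y. P y i)" if "i < m" for i
    unfolding P_def by (intro continuous_intros cw H G' that)
  then have cP: "continuous_map B euclideanreal (\<lambda>y. l1 m (P y))" by (intro continuous_intros)
  have P0: "0 < l1 m (P y)" if y: "y \<in> R" for y
  proof (cases "y \<in> Z")
    case True
    then have "w y = 0" using w(2) by blast
    then have "l1 m (P y) = l1 m (G y)" using G'(2)[OF _ y] by (intro l1_cong) (simp add: P_def)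
    then show ?thesis using G(3)[OF y] by simp
  next
    case False
    then have "1 / 2 < l1 m (H y)" using y by (auto simp: Z_def)
    moreover have "l1 m (H y) = l1 m (\<lambda>i. P y i + (w y - 1) * (G y i - H y i))"
      using G'(2)[OF _ y] by (intro l1_cong) (simp add: P_def algebra_simps)
    moreover have "\<dots> \<le> l1 m (P y) + \<bar>w y - 1\<bar> * l1 m (\<lambda>i. G y i - H y i)"
      using l1_triangle[of m "P y" "\<lambda>i. (w y - 1) * (G y i - H y i)"] by (simp add: l1_scale)
    moreover have "\<bar>w y - 1\<bar> * l1 m (\<lambda>i. G y i - H y i) \<le> 1 * (1 / 2)"
      using w01[of y] y G(2)[OF y] by (intro mult_mono) (auto simp: l1_nonneg)
    ultimately show ?thesis by linarith
  qed

  \<comment> \<open>The prescribed values zero on \<open>R\<close> and \<open>1 / N\<close> on \<open>A\<close> fit together since \<open>s\<close> vanishes on \<open>R \<inter> cA\<close>.\<close>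
  have cS: "continuous_map (subtopology B (R \<union> cA)) euclideanreal (\<lambda>y. if y \<in> R then 0 else s y)"
  proof (rule pasting_lemma_closed[where I = "{True, False}" and T = "\<lambda>b. if b then R else cA"
        and f = "\<lambda>b. if b then (\<lambda>_. 0) else s"])
    show "closedin (subtopology B (R \<union> cA)) (if b then R else cA)" for b
      using closedin_R clcA by (auto intro!: closedin_subset_topspace)
    show "continuous_map (subtopology (subtopology B (R \<union> cA)) (if b then R else cA)) euclideanreal
        (if b then \<lambda>_. 0 else s)" for b
      using s(1) by (auto intro!: continuous_map_from_subtopology)
  qed (use s0 in auto)
  obtain S' where S': "continuous_map B euclideanreal S'"
    "\<And>y. y \<in> R \<union> cA \<Longrightarrow> S' y = (if y \<in> R then 0 else s y)"
    by (rule Tietze_extension_realinterval[OF normal_B closedin_Un[OF closedin_R clcA] is_interval_univ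
          UNIV_not_empty cS]) (rule subset_UNIV, rule that)
  define S where "S y = max 0 (S' y)" for y
  have cS: "continuous_map B euclideanreal S" unfolding S_def by (intro continuous_intros S') 
  have SR: "S y = 0" if "y \<in> R" for y using S'(2)[of y] that by (simp add: S_def)
  have SA: "S (e x) = 1 / N x" if "x \<in> A" for x
  proof -
    have "e x \<notin> R" using that AX by blast
    then have "S' (e x) = s (e x)" using S'(2)[OF UnI2[OF AcA[OF that]]] by (simp only: if_False)
    also have "\<dots> = 1 / N x" using that AX s(2) s'(3) by auto
    finally show ?thesis using N1[of x] by (simp add: S_def)
  qed
  \<comment> \<open>\<open>S\<close> may vanish at points of \<open>X\<close> away from \<open>A\<close>; there a multiple of \<open>q\<close> is added.\<close>
  define Y where "Y = {x \<in> topspace X. S (e x) \<le> 0}"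
  have "closedin X Y" unfolding Y_def by (intro closedin_le continuous_e_compose cS) simp
  moreover have "disjnt A Y"
  proof -
    have "0 < S (e x)" if "x \<in> A" for x using SA[OF that] N1[of x] by simp
    then show ?thesis by (force simp: Y_def disjnt_def)
  qed
  ultimately obtain u :: "_ \<Rightarrow> real" where u: "continuous_map X (top_of_set {0..1}) u" "u ` A \<subseteq> {0}" "u ` Y \<subseteq> {1}"
    using Urysohn_lemma[OF normal_X clA _ _ zero_le_one] by blast
  have cu: "continuous_map X euclideanreal u" using u(1) by (simp add: continuous_map_in_subtopology)
  have u01: "0 \<le> u x" "u x \<le> 1" if "x \<in> topspace X" for x
    using continuous_map_funspace[OF u(1)] that by auto
  define d where "d x = S (e x) + u x * q (e x)" for x
  have cd: "continuous_map X euclideanreal d"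
    unfolding d_def by (intro continuous_intros continuous_e_compose cS cu q)
  have d0: "0 < d x" if "x \<in> topspace X" for x
  proof (cases "x \<in> Y")
    case True
    then have "u x = 1" using u(3) by blast
    then show ?thesis using q(3)[OF that] by (simp add: d_def S_def add_nonneg_pos)
  next
    case False
    then have "0 < S (e x)" using that by (auto simp: Y_def)
    then show ?thesis using q(3)[OF that] u01[OF that] by (simp add: d_def add_pos_nonneg)
  qed
  have dle: "d x \<le> S (e x) + q (e x)" if "x \<in> topspace X" for x
    using q(3)[OF that] u01[OF that] by (simp add: d_def mult_left_le_one_le)
  have dA: "d x = 1 / N x" if "x \<in> A" for x using u(2) that SA[OF that] by (auto simp: d_def)

  define g where "g x = (\<lambda>i. if i < m then P (e x) i / d x else 0)" for x
  have l1g: "l1 m (g x) = l1 m (P (e x)) / d x" if "x \<in> topspace X" for x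
  proof -
    have "l1 m (g x) = l1 m (\<lambda>i. P (e x) i / d x)" by (intro l1_cong) (simp add: g_def)
    then show ?thesis using d0[OF that] by (simp add: l1_divide)
  qed
  have gcont: "continuous_map X (Euclidean_space m) g"
    unfolding g_def continuous_map_componentwise_Euclidean_space
  proof (intro allI impI continuous_map_real_divide continuous_e_compose cPi cd)
    show "d x \<noteq> 0" if "x \<in> topspace X" for x using d0[OF that] by simp
  qed
  have "proper_continuous_map X (Euclidean_space m) g"
    unfolding proper_continuous_map_Euclidean_space_iff
  proof (intro conjI gcont allI)
    fix M
    \<comment> \<open>As \<open>d\<close> lives on \<open>X\<close> only, it is bounded by a function on \<open>B\<close> that vanishes on the remainder.\<close>
    define T where "T = {y \<in> topspace B. l1 m (P y) \<le> \<bar>M\<bar> * (S y + q y)}"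
    have "closedin B T"
      unfolding T_def by (intro closedin_le cP continuous_map_real_mult_left continuous_map_add cS q(1))
    moreover have "T \<inter> R = {}"
      using P0 SR q(2) by (force simp: T_def)
    ultimately have "compactin X {x \<in> topspace X. e x \<in> T}" by (rule compactin_preimage)
    moreover have "{x \<in> topspace X. l1 m (g x) \<le> M} \<subseteq> {x \<in> topspace X. e x \<in> T}"
    proof (intro subsetI CollectI conjI)
      fix x assume "x \<in> {x \<in> topspace X. l1 m (g x) \<le> M}"
      then have x: "x \<in> topspace X" "l1 m (g x) \<le> M" by auto
      show "x \<in> topspace X" by fact
      have "l1 m (P (e x)) \<le> M * d x" using x l1g[OF x(1)] d0[OF x(1)] by (simp add: pos_divide_le_eq)
      also have "\<dots> \<le> \<bar>M\<bar> * (S (e x) + q (e x))"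
        using d0[OF x(1)] dle[OF x(1)] by (intro mult_mono) auto
      finally show "e x \<in> T" using e_in[OF x(1)] by (simp add: T_def)
    qed
    moreover have "closedin X {x \<in> topspace X. l1 m (g x) \<le> M}"
      by (intro closedin_le continuous_map_l1 continuous_map_Euclidean_space_component[OF gcont]) simp
    ultimately show "compactin X {x \<in> topspace X. l1 m (g x) \<le> M}"
      by (rule closed_compactin)
  qed
  moreover have "g x = f x" if x: "x \<in> A" for x
  proof
    fix i
    have "w (e x) = 1" using w(3) AcA[OF x] by blast
    then show "g x i = f x i"
      using HA[OF x, of i] dA[OF x] N0[of x] f0[OF x, of i] by (cases "i < m") (auto simp: g_def P_def)
  qed
  ultimately show "\<exists>g. proper_continuous_map X (Euclidean_space (n + 1)) g \<and> (\<forall>x\<in>A. g x = f x)"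
    unfolding m_def by blast
qed

end

theorem corollary4p3:
  fixes X :: "'a topology" and n :: nat
  assumes "tychonoff_space X"
    and "locally_compact_space X"
    and "Lindelof_space X"
  shows "covering_dim_le (stone_cech_remainder X) n \<longleftrightarrow> proper_dim_le X (n + 1)"
proof -
  interpret locally_compact_Lindelof X
    using assms by unfold_locales
  show ?thesis
    using covering_dim_le_imp_proper_dim_le nonvanishing_extension_imp_covering_dim_le
      proper_dim_le_imp_nonvanishing_extension by blast
qed

end
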